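(* Every tree $T$ with pathwidth $k\geq 1$ has a plane straight-line drawing using at most $\max\{\Delta(T)-1,1\}$ distinct edge slopes and at most $2k-1$ distinct edge lengths.
   Context: $\Delta(T)$ is the maximum degree of $T$. A (straight-line) drawing of a graph maps its vertices to distinct points in the plane and represents each edge by the closed line segment between its endpoints, such that each edge segment intersects no vertex other than its own endpoints; it is plane if no two edges intersect except at a common endpoint. The slope of an edge is the angle in $[0,\pi)$ from the $x$-axis to the line containing it. The pathwidth of a graph $G$ is the minimum $k$ such that $G$ is a spanning subgraph of an interval graph with no clique on $k+2$ vertices. *)

theory Defs
  imports "HOL-Analysis.Analysis" "HOL-Library.Ramsey"
begin

text \<open>A finite simple graph is a pair of a vertex set \<open>V\<close> and a set \<open>E\<close> of two-element subsets
  of \<open>V\<close>.  The \<open>tree\<close> predicate of the AFP entry \<open>Graph_Theory\<close> is not used: it forbids directed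
  cycles, so it fails for a symmetric digraph with an edge and holds for some orientations
  of undirected cycles.\<close>

definition simple_graph :: "'a set \<Rightarrow> 'a set set \<Rightarrow> bool" where
  "simple_graph V E \<longleftrightarrow> finite V \<and> E \<subseteq> nsets V 2"

definition graph_connected :: "'a set \<Rightarrow> 'a set set \<Rightarrow> bool" where
  "graph_connected V E \<longleftrightarrow> V \<noteq> {} \<and> (\<forall>u\<in>V. \<forall>v\<in>V. (u, v) \<in> {(x, y). {x, y} \<in> E}\<^sup>*)"

definition graph_cycle :: "'a set set \<Rightarrow> 'a list \<Rightarrow> bool" where
  "graph_cycle E vs \<longleftrightarrow> 3 \<le> length vs \<and> distinct vs \<and>
     (\<forall>i < length vs. {vs ! i, vs ! (Suc i mod length vs)} \<in> E)"

definition graph_tree :: "'a set \<Rightarrow> 'a set set \<Rightarrow> bool" where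
  "graph_tree V E \<longleftrightarrow> simple_graph V E \<and> graph_connected V E \<and> (\<nexists>vs. graph_cycle E vs)"

definition vertex_degree :: "'a set set \<Rightarrow> 'a \<Rightarrow> nat" where
  "vertex_degree E v = card {e \<in> E. v \<in> e}"

definition max_degree :: "'a set \<Rightarrow> 'a set set \<Rightarrow> nat" where
  "max_degree V E = Max (vertex_degree E ` V)"

definition interval_graph :: "'a set \<Rightarrow> 'a set set \<Rightarrow> bool" where
  "interval_graph V E \<longleftrightarrow> simple_graph V E \<and>
     (\<exists>l r :: 'a \<Rightarrow> real. (\<forall>v\<in>V. l v \<le> r v) \<and>
       (\<forall>u\<in>V. \<forall>v\<in>V. u \<noteq> v \<longrightarrow> ({u, v} \<in> E \<longleftrightarrow> {l u..r u} \<inter> {l v..r v} \<noteq> {})))"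

definition pathwidth :: "'a set \<Rightarrow> 'a set set \<Rightarrow> nat" where
  "pathwidth V E = (LEAST k. \<exists>F. interval_graph V F \<and> E \<subseteq> F \<and>
     \<not> (\<exists>K. K \<subseteq> V \<and> card K = k + 2 \<and> clique K F))"

text \<open>The predicate under \<open>LEAST\<close> is satisfiable: all intervals may be equal.\<close>

lemma pathwidth_witness:
  assumes "simple_graph V E"
  shows "\<exists>k F. interval_graph V F \<and> E \<subseteq> F \<and> \<not> (\<exists>K. K \<subseteq> V \<and> card K = k + 2 \<and> clique K F)"
proof (intro exI conjI)
  have "finite V" using assms by (simp add: simple_graph_def)
  show "interval_graph V (nsets V 2)"
    unfolding interval_graph_def simple_graph_def
    using \<open>finite V\<close>
    by (auto simp: nsets_def intro!: exI[of _ "\<lambda>_. 0"])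
  show "E \<subseteq> nsets V 2" using assms by (simp add: simple_graph_def)
  show "\<not> (\<exists>K. K \<subseteq> V \<and> card K = card V + 2 \<and> clique K (nsets V 2))"
  proof
    assume "\<exists>K. K \<subseteq> V \<and> card K = card V + 2 \<and> clique K (nsets V 2)"
    then obtain K where "K \<subseteq> V" "card K = card V + 2" by blast
    then show False using card_mono[OF \<open>finite V\<close>, of K] by linarith
  qed
qed

text \<open>The plane is the type \<^typ>\<open>complex\<close>.\<close>

definition straight_line_drawing :: "'a set \<Rightarrow> 'a set set \<Rightarrow> ('a \<Rightarrow> complex) \<Rightarrow> bool" where
  "straight_line_drawing V E p \<longleftrightarrow> inj_on p V \<and>
     (\<forall>u v. {u, v} \<in> E \<longrightarrow> (\<forall>w\<in>V. p w \<in> closed_segment (p u) (p v) \<longrightarrow> w \<in> {u, v}))"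

definition plane_drawing :: "'a set \<Rightarrow> 'a set set \<Rightarrow> ('a \<Rightarrow> complex) \<Rightarrow> bool" where
  "plane_drawing V E p \<longleftrightarrow> straight_line_drawing V E p \<and>
     (\<forall>u v x y. {u, v} \<in> E \<longrightarrow> {x, y} \<in> E \<longrightarrow> {u, v} \<noteq> {x, y} \<longrightarrow>
        closed_segment (p u) (p v) \<inter> closed_segment (p x) (p y) \<subseteq> p ` ({u, v} \<inter> {x, y}))"

text \<open>The factor \<open>r\<close> may be negative, so the value depends only on the line through
  \<open>a\<close> and \<open>b\<close>, not on the order of the two points.\<close>

definition slope :: "complex \<Rightarrow> complex \<Rightarrow> real" where
  "slope a b = (THE \<theta>. 0 \<le> \<theta> \<and> \<theta> < pi \<and> (\<exists>r::real. b - a = of_real r * cis \<theta>))"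

lemma slope_unique:
  assumes "a \<noteq> b"
  shows "\<exists>!\<theta>. 0 \<le> \<theta> \<and> \<theta> < pi \<and> (\<exists>r::real. b - a = of_real r * cis \<theta>)"
proof -
  define z where "z = b - a"
  have "z \<noteq> 0" using assms by (simp add: z_def)
  have z: "z = of_real (cmod z) * cis (Arg z)"
    using rcis_cmod_Arg[of z] unfolding rcis_def by (rule sym)
  show ?thesis unfolding z_def[symmetric]
  proof (rule ex_ex1I)
    show "\<exists>\<theta>. 0 \<le> \<theta> \<and> \<theta> < pi \<and> (\<exists>r::real. z = of_real r * cis \<theta>)"
    proof -
      consider "0 \<le> Arg z" "Arg z < pi" | "Arg z = pi" | "Arg z < 0" "- pi < Arg z"
        using Arg_bounded[of z] by linarith
      then show ?thesis
      proof cases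
        case 1
        then show ?thesis using z by blast
      next
        case 2
        then have "z = of_real (- cmod z) * cis 0" by (subst z) simp
        then show ?thesis using pi_gt_zero by blast
      next
        case 3
        have "cis (Arg z + pi) = - cis (Arg z)" by (simp add: complex_eq_iff)
        then have "z = of_real (- cmod z) * cis (Arg z + pi)" by (subst z) simp
        moreover have "0 \<le> Arg z + pi" "Arg z + pi < pi" using 3 by auto
        ultimately show ?thesis by blast
      qed
    qed
  next
    fix s t
    assume s: "0 \<le> s \<and> s < pi \<and> (\<exists>r::real. z = of_real r * cis s)"
      and t: "0 \<le> t \<and> t < pi \<and> (\<exists>r::real. z = of_real r * cis t)"
    then obtain q r where q: "z = of_real q * cis s" and r: "z = of_real r * cis t" by blast
    have "q \<noteq> 0" using q \<open>z \<noteq> 0\<close> by auto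
    have "of_real q * cis s * cis (- t) = of_real r * cis t * cis (- t)" using q r by simp
    then have "of_real q * cis (s - t) = of_real r"
      by (simp add: mult.assoc cis_mult)
    then have "Im (of_real q * cis (s - t)) = Im (of_real r)" by simp
    then have "sin (s - t) = 0" using \<open>q \<noteq> 0\<close> by simp
    then show "s = t" using s t sin_eq_0_pi[of "s - t"] by linarith
  qed
qed

definition edge_slopes :: "'a set set \<Rightarrow> ('a \<Rightarrow> complex) \<Rightarrow> real set" where
  "edge_slopes E p = {slope (p u) (p v) | u v. {u, v} \<in> E}"

definition edge_lengths :: "'a set set \<Rightarrow> ('a \<Rightarrow> complex) \<Rightarrow> real set" where
  "edge_lengths E p = {dist (p u) (p v) | u v. {u, v} \<in> E}"

end

theory Submission
  imports Defs
begin

text \<open>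
  In an interval representation of width \<open>k\<close>, a path of the tree from a vertex with leftmost
  interval to one with rightmost interval covers every point of the representation, so removing it
  leaves components of pathwidth less than \<open>k\<close>.  Hence, by induction on \<open>k\<close>, a tree with an
  arbitrary root decomposes into nested downward heavy paths with at most \<open>2 * k\<close> levels: follow
  the path from the root until it reaches the covering path and then one half of that path; the other
  half starts a heavy path of level \<open>2 * k - 1\<close>.  If the root is an end of the covering
  path, \<open>2 * k - 1\<close> levels suffice; prolonging the path makes the root a leaf, after which every
  vertex has at most \<open>\<Delta> - 1\<close> children.

  Assign one direction to each of the \<open>\<Delta> - 1\<close> child positions: heavy edges are horizontal, the
  others have angles strictly between 60 and 90 degrees, and all edges of a level, including those
  to the heavy paths one level below, have the same length.  If the lengths decrease fast enough from
  level to level, subtrees hanging off a heavy path are tiny and nothing crosses.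
\<close>

subsection \<open>Rooted trees and heavy paths\<close>

datatype (verts: 'a) rtree = Node (apex: 'a) (children: "'a rtree list")

fun edges :: "'a rtree \<Rightarrow> 'a set set" where
  "edges (Node a cs) = (\<Union>c\<in>set cs. insert {a, apex c} (edges c))"

fun proper :: "'a rtree \<Rightarrow> bool" where
  "proper (Node a cs) \<longleftrightarrow> distinct cs \<and> (\<forall>c\<in>set cs. a \<notin> verts c) \<and>
     (\<forall>c\<in>set cs. \<forall>c'\<in>set cs. c \<noteq> c' \<longrightarrow> verts c \<inter> verts c' = {}) \<and> (\<forall>c\<in>set cs. proper c)"

fun arity_le :: "nat \<Rightarrow> 'a rtree \<Rightarrow> bool" where
  "arity_le d (Node a cs) \<longleftrightarrow> length cs \<le> d \<and> (\<forall>c\<in>set cs. arity_le d c)"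

text \<open>The first child continues the current heavy path, at the same level; every other child
  starts a heavy path one level below.\<close>

fun rank_le :: "nat \<Rightarrow> 'a rtree \<Rightarrow> bool" where
  "rank_le m (Node a []) \<longleftrightarrow> True"
| "rank_le m (Node a (c # cs)) \<longleftrightarrow> 1 \<le> m \<and> rank_le m c \<and> (\<forall>x\<in>set cs. rank_le (m - 1) x)"

lemma apex_in_verts [simp]: "apex t \<in> verts t"
  by (cases t) simp

lemma finite_verts [simp]: "finite (verts t)"
  by (induction t) simp

lemma edges_subset: "e \<in> edges t \<Longrightarrow> e \<subseteq> verts t"
proof (induction t)
  case (Node a cs)
  then obtain c where "c \<in> set cs" "e = {a, apex c} \<or> e \<in> edges c" by auto
  moreover from this have "e \<subseteq> insert a (verts c)" using Node.IH[of c] apex_in_verts[of c] by auto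
  ultimately show ?case by auto
qed

lemma edge_in_verts:
  assumes "{u, v} \<in> edges t"
  shows "u \<in> verts t" "v \<in> verts t"
  using edges_subset[OF assms] by auto

lemma rank_le_mono: "rank_le m t \<Longrightarrow> m \<le> n \<Longrightarrow> rank_le n t"
proof (induction m t arbitrary: n rule: rank_le.induct)
  case (2 m a c cs)
  have "rank_le (n - 1) x" if "x \<in> set cs" for x
    using "2.IH"(2)[OF that] "2.prems" that by (auto simp: diff_le_mono)
  then show ?case using 2 by auto
qed auto

text \<open>\<open>rank_le\<close> depends on which child comes first, so heavy paths are chosen by
  permuting children. Apex, vertices and edges stay fixed so that a reordered subtree can replace
  the original in place.\<close>

definition reorderable :: "nat \<Rightarrow> nat \<Rightarrow> 'a rtree \<Rightarrow> bool" where
  "reorderable d m t \<longleftrightarrow> (\<exists>t'. apex t' = apex t \<and> verts t' = verts t \<and> edges t' = edges t \<and>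
     proper t' \<and> arity_le d t' \<and> rank_le m t')"

lemma reorderable_mono: "reorderable d m t \<Longrightarrow> m \<le> n \<Longrightarrow> reorderable d n t"
  unfolding reorderable_def using rank_le_mono by blast

lemma reorderable_leaf: "reorderable d m (Node a [])"
  unfolding reorderable_def by (rule exI[of _ "Node a []"]) simp

text \<open>Moving \<open>h\<close> to the front lets it continue the heavy path through
  \<open>a\<close>; the other children start heavy paths one level below.\<close>

lemma reorderable_Node:
  assumes t: "proper (Node a cs)" "arity_le d (Node a cs)"
    and m: "1 \<le> m" and h: "h \<in> set cs" "reorderable d m h"
    and rest: "\<And>c. c \<in> set cs \<Longrightarrow> c \<noteq> h \<Longrightarrow> reorderable d (m - 1) c"
  shows "reorderable d m (Node a cs)"
proof -
  have "\<exists>c'. apex c' = apex c \<and> verts c' = verts c \<and> edges c' = edges c \<and> proper c' \<and>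
          arity_le d c' \<and> rank_le (if c = h then m else m - 1) c'" if "c \<in> set cs" for c
    using that h rest[of c] unfolding reorderable_def by auto
  then obtain f where f: "\<And>c. c \<in> set cs \<Longrightarrow> apex (f c) = apex c \<and> verts (f c) = verts c \<and>
      edges (f c) = edges c \<and> proper (f c) \<and> arity_le d (f c) \<and>
      rank_le (if c = h then m else m - 1) (f c)"
    by metis
  define xs where "xs = h # remove1 h cs"
  have xs: "set xs = set cs" "length xs = length cs" "distinct xs"
    using t(1) h(1) by (auto simp: xs_def length_remove1 intro: Suc_pred length_pos_if_in_set)
  \<comment> \<open>Keeps the new list of children distinct: equal images would have equal vertex
    sets, while those of different children are disjoint and nonempty.\<close>
  have f_inj: "inj_on f (set cs)"
  proof (rule inj_onI, rule ccontr)
    fix x y assume "x \<in> set cs" "y \<in> set cs" "f x = f y" "x \<noteq> y"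
    moreover from this have "verts x = verts y" using f by metis
    moreover have "verts x \<inter> verts y = {}"
      using t(1) \<open>x \<in> set cs\<close> \<open>y \<in> set cs\<close> \<open>x \<noteq> y\<close> by simp
    ultimately have "verts x = {}" by simp
    then show False using apex_in_verts[of x] by simp
  qed
  have "verts (Node a (map f xs)) = verts (Node a cs)" using f xs by auto
  moreover have "edges (Node a (map f xs)) = edges (Node a cs)" using f xs by simp
  moreover have "proper (Node a (map f xs))"
  proof -
    have "verts (f c) \<inter> verts (f c') = {}" if "c \<in> set cs" "c' \<in> set cs" "f c \<noteq> f c'" for c c'
      using f[OF that(1)] f[OF that(2)] that t(1) by (cases "c = c'") auto
    then show ?thesis using t(1) f f_inj xs by (auto simp: distinct_map simp del: Int_iff)
  qed
  moreover have "arity_le d (Node a (map f xs))" using t(2) f xs by simp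
  moreover have "rank_le m (Node a (map f xs))"
  proof -
    have "rank_le m (f h)" using f[OF h(1)] by simp
    moreover have "rank_le (m - 1) (f x)" if "x \<in> set (remove1 h cs)" for x
      using f[of x] that t(1) by auto
    ultimately show ?thesis using m unfolding xs_def by simp
  qed
  ultimately show ?thesis
    unfolding reorderable_def by (intro exI[of _ "Node a (map f xs)"]) simp
qed

text \<open>Paths are represented by their vertex sets.\<close>

inductive down_path :: "'a rtree \<Rightarrow> 'a set \<Rightarrow> bool" where
  down_top: "down_path (Node a cs) {a}"
| down_step: "c \<in> set cs \<Longrightarrow> down_path c P \<Longrightarrow> down_path (Node a cs) (insert a P)"

text \<open>A path of a rooted tree descends from its topmost vertex into at most two children. That
  vertex need not be the root, hence \<open>bent_step\<close>.\<close>

inductive bent_path :: "'a rtree \<Rightarrow> 'a set \<Rightarrow> bool" where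
  bent_down: "down_path t P \<Longrightarrow> bent_path t P"
| bent_step: "c \<in> set cs \<Longrightarrow> bent_path c P \<Longrightarrow> bent_path (Node a cs) P"
| bent_join: "c \<in> set cs \<Longrightarrow> c' \<in> set cs \<Longrightarrow> c \<noteq> c' \<Longrightarrow> down_path c P \<Longrightarrow> down_path c' Q \<Longrightarrow>
    bent_path (Node a cs) (insert a (P \<union> Q))"

lemma down_path_subset: "down_path t P \<Longrightarrow> P \<subseteq> verts t"
  by (induction rule: down_path.induct) auto

lemma bent_path_subset: "bent_path t P \<Longrightarrow> P \<subseteq> verts t"
  by (induction rule: bent_path.induct) (auto dest: down_path_subset)

section \<open>Covering paths in interval representations\<close>

locale intervals =
  fixes l r :: "'a \<Rightarrow> real"
  assumes l_le_r: "\<And>v. l v \<le> r v"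
begin

text \<open>Pairwise meeting intervals share a point, so this bounds the clique number of the
  interval graph by \<open>k\<close>; pathwidth at most \<open>k\<close> corresponds to
  \<open>thin (Suc k)\<close>.\<close>

definition thin :: "nat \<Rightarrow> 'a set \<Rightarrow> bool" where
  "thin k S \<longleftrightarrow> (\<forall>x. card {v \<in> S. l v \<le> x \<and> x \<le> r v} \<le> k)"

text \<open>An edge is read in both orders, and the two inequalities together say that the intervals
  intersect.\<close>

definition meeting :: "'a set set \<Rightarrow> bool" where
  "meeting E \<longleftrightarrow> (\<forall>u v. {u, v} \<in> E \<longrightarrow> l u \<le> r v)"

lemma thin_subset:
  assumes "thin k S" "S' \<subseteq> S" "finite S"
  shows "thin k S'"
  unfolding thin_def
proof
  fix x
  have "card {v \<in> S'. l v \<le> x \<and> x \<le> r v} \<le> card {v \<in> S. l v \<le> x \<and> x \<le> r v}"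
    using assms(2,3) by (intro card_mono) auto
  then show "card {v \<in> S'. l v \<le> x \<and> x \<le> r v} \<le> k"
    using assms(1) unfolding thin_def by (meson le_trans)
qed

text \<open>A point in the interval of some member of \<open>S\<close> lies between
  \<open>l va\<close> and \<open>r vb\<close>, so an interval of \<open>P\<close> contains it;
  removing \<open>P\<close> lowers the count there by at least one.\<close>

lemma thin_remove_cover:
  assumes "finite S" "thin (Suc k) S" "P \<subseteq> S"
    and va: "va \<in> S" "\<And>v. v \<in> S \<Longrightarrow> l va \<le> l v"
    and vb: "vb \<in> S" "\<And>v. v \<in> S \<Longrightarrow> r v \<le> r vb"
    and cov: "\<And>x. l va \<le> x \<Longrightarrow> x \<le> r vb \<Longrightarrow> \<exists>w\<in>P. l w \<le> x \<and> x \<le> r w"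
  shows "thin k (S - P)"
  unfolding thin_def
proof
  fix x
  let ?A = "{v \<in> S - P. l v \<le> x \<and> x \<le> r v}"
  let ?B = "{v \<in> S. l v \<le> x \<and> x \<le> r v}"
  show "card ?A \<le> k"
  proof (cases "?A = {}")
    case True
    then show ?thesis by (metis card.empty le0)
  next
    case False
    then obtain v where "v \<in> S" "l v \<le> x" "x \<le> r v" by blast
    then have "l va \<le> x" "x \<le> r vb" using va(2)[of v] vb(2)[of v] by linarith+
    then obtain w where w: "w \<in> P" "l w \<le> x" "x \<le> r w" using cov by blast
    have "?A \<subset> ?B" using w \<open>P \<subseteq> S\<close> by auto
    then have "card ?A < card ?B" using \<open>finite S\<close> by (intro psubset_card_mono) auto
    also have "\<dots> \<le> Suc k" using assms(2) unfolding thin_def by blast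
    finally show ?thesis by simp
  qed
qed

lemma meeting_child:
  assumes "meeting (edges (Node a cs))" "c \<in> set cs"
  shows "meeting (edges c)" "l a \<le> r (apex c)" "l (apex c) \<le> r a"
proof -
  show "meeting (edges c)" using assms unfolding meeting_def by auto
  have "{a, apex c} \<in> edges (Node a cs)" "{apex c, a} \<in> edges (Node a cs)"
    using assms(2) by (auto simp: insert_commute)
  then show "l a \<le> r (apex c)" "l (apex c) \<le> r a" using assms(1) unfolding meeting_def by blast+
qed

text \<open>Intervals of adjacent vertices meet, so those along the path from the apex to
  \<open>v\<close> leave no gap. Both directions are kept because \<open>v\<close> may serve as the
  left or as the right end of a bent path.\<close>

lemma down_path_cover:
  assumes "meeting (edges t)" "v \<in> verts t"
  shows "\<exists>P. down_path t P \<and>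
    (\<forall>x. l (apex t) \<le> x \<longrightarrow> x \<le> r v \<longrightarrow> (\<exists>w\<in>P. l w \<le> x \<and> x \<le> r w)) \<and>
    (\<forall>x. l v \<le> x \<longrightarrow> x \<le> r (apex t) \<longrightarrow> (\<exists>w\<in>P. l w \<le> x \<and> x \<le> r w))"
  using assms
proof (induction t)
  case (Node a cs)
  show ?case
  proof (cases "v = a")
    case True
    then show ?thesis by (intro exI[of _ "{a}"]) (auto intro: down_top)
  next
    case False
    then obtain c where c: "c \<in> set cs" "v \<in> verts c" using Node.prems by auto
    note m = meeting_child[OF Node.prems(1) c(1)]
    from Node.IH[OF c(1) m(1) c(2)] obtain P where P: "down_path c P"
      "\<And>x. l (apex c) \<le> x \<Longrightarrow> x \<le> r v \<Longrightarrow> \<exists>w\<in>P. l w \<le> x \<and> x \<le> r w"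
      "\<And>x. l v \<le> x \<Longrightarrow> x \<le> r (apex c) \<Longrightarrow> \<exists>w\<in>P. l w \<le> x \<and> x \<le> r w"
      by blast
    have "\<exists>w\<in>insert a P. l w \<le> x \<and> x \<le> r w" if "l a \<le> x" "x \<le> r v" for x
      using that m P(2)[of x] by (cases "x \<le> r a") auto
    moreover have "\<exists>w\<in>insert a P. l w \<le> x \<and> x \<le> r w" if "l v \<le> x" "x \<le> r a" for x
      using that m P(3)[of x] by (cases "l a \<le> x") auto
    ultimately show ?thesis
      using down_step[OF c(1) P(1)] by (intro exI[of _ "insert a P"]) auto
  qed
qed

text \<open>The recursion descends while \<open>u\<close> and \<open>v\<close> lie below the same
  child. Where they part, two downward paths are joined, unless one of the two vertices is the
  root.\<close>

lemma bent_path_cover: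
  assumes "meeting (edges t)" "u \<in> verts t" "v \<in> verts t"
  shows "\<exists>P. bent_path t P \<and> (\<forall>x. l u \<le> x \<longrightarrow> x \<le> r v \<longrightarrow> (\<exists>w\<in>P. l w \<le> x \<and> x \<le> r w))"
  using assms
proof (induction t)
  case (Node a cs)
  consider "u = a" | "v = a" | "u \<noteq> a" "v \<noteq> a" by blast
  then show ?case
  proof cases
    case 1
    obtain P where "down_path (Node a cs) P"
      "\<And>x. l a \<le> x \<Longrightarrow> x \<le> r v \<Longrightarrow> \<exists>w\<in>P. l w \<le> x \<and> x \<le> r w"
      using down_path_cover[OF Node.prems(1,3)] by auto
    with 1 show ?thesis using bent_down by blast
  next
    case 2
    obtain P where "down_path (Node a cs) P"
      "\<And>x. l u \<le> x \<Longrightarrow> x \<le> r a \<Longrightarrow> \<exists>w\<in>P. l w \<le> x \<and> x \<le> r w"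
      using down_path_cover[OF Node.prems(1,2)] by auto
    with 2 show ?thesis using bent_down by blast
  next
    case 3
    then obtain c c' where c: "c \<in> set cs" "u \<in> verts c" and c': "c' \<in> set cs" "v \<in> verts c'"
      using Node.prems by auto
    note m = meeting_child[OF Node.prems(1) c(1)] and m' = meeting_child[OF Node.prems(1) c'(1)]
    show ?thesis
    proof (cases "c = c'")
      case True
      then show ?thesis using Node.IH[OF c(1) m(1) c(2)] c' bent_step by metis
    next
      case False
      obtain P where P: "down_path c P"
        "\<And>x. l u \<le> x \<Longrightarrow> x \<le> r (apex c) \<Longrightarrow> \<exists>w\<in>P. l w \<le> x \<and> x \<le> r w"
        using down_path_cover[OF m(1) c(2)] by blast
      obtain Q where Q: "down_path c' Q"
        "\<And>x. l (apex c') \<le> x \<Longrightarrow> x \<le> r v \<Longrightarrow> \<exists>w\<in>Q. l w \<le> x \<and> x \<le> r w"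
        using down_path_cover[OF m'(1) c'(2)] by blast
      have "\<exists>w\<in>insert a (P \<union> Q). l w \<le> x \<and> x \<le> r w" if "l u \<le> x" "x \<le> r v" for x
      proof -
        \<comment> \<open>Points left of the interval of \<open>a\<close> fall to the branch of
          \<open>u\<close>, points right of it to the branch of \<open>v\<close>.\<close>
        consider "x < l a" | "r a < x" | "l a \<le> x" "x \<le> r a" by linarith
        then show ?thesis
        proof cases
          case 1
          then show ?thesis using that P(2)[of x] m by auto
        next
          case 2
          then show ?thesis using that Q(2)[of x] m' by auto
        qed auto
      qed
      then show ?thesis using bent_join[OF c(1) c'(1) False P(1) Q(1)] by blast
    qed
  qed
qed

section \<open>Reordering along covering paths\<close>

lemma thin_child:
  assumes "thin k (verts (Node a cs) - P)" "c \<in> set cs" "verts c \<inter> P \<subseteq> Q"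
  shows "thin k (verts c - Q)"
  using assms by (auto intro!: thin_subset[OF assms(1)])

text \<open>The path becomes part of the top heavy path. Subtrees hanging off it avoid
  \<open>P\<close>, so \<open>H\<close> orders them with \<open>m\<close> levels, and the path adds
  one.\<close>

lemma reorder_down_path:
  assumes H: "\<And>t. proper t \<Longrightarrow> arity_le d t \<Longrightarrow> meeting (edges t) \<Longrightarrow> thin k (verts t) \<Longrightarrow>
      reorderable d m t"
    and "down_path t P" "proper t" "arity_le d t" "meeting (edges t)" "thin k (verts t - P)"
  shows "reorderable d (Suc m) t"
  using assms(2-)
proof (induction rule: down_path.induct)
  case (down_top a cs)
  have *: "reorderable d m c" if "c \<in> set cs" for c
    using that down_top meeting_child[OF _ that] thin_child[OF down_top(4) that, of "{}"]
    by (intro H) auto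
  \<comment> \<open>At the lower end of the path any child may be put first, as \<open>m\<close>
    levels are within \<open>Suc m\<close>.\<close>
  show ?case
  proof (cases cs)
    case Nil
    then show ?thesis by (simp add: reorderable_leaf)
  next
    case (Cons c cs')
    show ?thesis
      by (rule reorderable_Node[where h = c])
        (use down_top * Cons in \<open>auto intro: reorderable_mono[of d m]\<close>)
  qed
next
  case (down_step c cs P a)
  have P: "P \<subseteq> verts c" using down_path_subset[OF down_step(2)] .
  have "reorderable d (Suc m) c"
    using down_step meeting_child[OF _ down_step(1)]
      thin_child[OF down_step.prems(4) down_step(1), of P]
    by (intro down_step.IH) auto
  moreover have "reorderable d m c'" if "c' \<in> set cs" "c' \<noteq> c" for c'
  proof -
    have "verts c' \<inter> verts c = {}" "a \<notin> verts c'" using down_step that by auto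
    then have "thin k (verts c' - {})"
      using P by (intro thin_child[OF down_step.prems(4) that(1)]) auto
    then show ?thesis using down_step that meeting_child[OF _ that(1)] by (intro H) auto
  qed
  ultimately show ?case
    using down_step by (intro reorderable_Node[where h = c]) auto
qed

text \<open>The heavy path from the root runs to the bend and on along one half, at level
  \<open>m + 2\<close>. The other half starts a heavy path of level \<open>m + 1\<close>, which
  leaves \<open>m\<close> levels below it.\<close>

lemma reorder_bent_path:
  assumes H: "\<And>t. proper t \<Longrightarrow> arity_le d t \<Longrightarrow> meeting (edges t) \<Longrightarrow> thin k (verts t) \<Longrightarrow>
      reorderable d m t"
    and "bent_path t P" "proper t" "arity_le d t" "meeting (edges t)" "thin k (verts t - P)"
  shows "reorderable d (m + 2) t"
  using assms(2-)
proof (induction rule: bent_path.induct)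
  case (bent_down t P)
  have "reorderable d (Suc m) t"
    by (rule reorder_down_path[OF H bent_down(1)]) (use bent_down in auto)
  then show ?case by (rule reorderable_mono) simp
next
  case (bent_step c cs P a)
  have P: "P \<subseteq> verts c" using bent_path_subset[OF bent_step(2)] .
  have "reorderable d (m + 2) c"
    using bent_step meeting_child[OF _ bent_step(1)]
      thin_child[OF bent_step.prems(4) bent_step(1), of P]
    by (intro bent_step.IH) auto
  moreover have "reorderable d (m + 1) c'" if "c' \<in> set cs" "c' \<noteq> c" for c'
  proof -
    have "verts c' \<inter> verts c = {}" using bent_step that by auto
    then have "thin k (verts c' - {})"
      using P by (intro thin_child[OF bent_step.prems(4) that(1)]) auto
    then have "reorderable d m c'"
      using bent_step that meeting_child[OF _ that(1)] by (intro H) auto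
    then show ?thesis by (rule reorderable_mono) simp
  qed
  ultimately show ?case
    using bent_step by (intro reorderable_Node[where h = c]) auto
next
  case (bent_join c cs c' P Q a)
  have P: "P \<subseteq> verts c" "Q \<subseteq> verts c'" using bent_join(4,5) by (auto dest: down_path_subset)
  have disj: "verts c \<inter> verts c' = {}" "a \<notin> verts c" "a \<notin> verts c'" using bent_join by auto
  have "thin k (verts c - P)" "thin k (verts c' - Q)"
    using P disj bent_join(1,2)
    by (auto intro!: thin_child[OF bent_join.prems(4)])
  then have "reorderable d (Suc m) c" "reorderable d (Suc m) c'"
    using bent_join meeting_child[OF bent_join.prems(3)]
    by (auto intro!: reorder_down_path[OF H bent_join(4)] reorder_down_path[OF H bent_join(5)])
  moreover have "reorderable d m c''" if "c'' \<in> set cs" "c'' \<noteq> c" "c'' \<noteq> c'" for c''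
  proof -
    have "verts c'' \<inter> verts c = {}" "verts c'' \<inter> verts c' = {}" "a \<notin> verts c''"
      using bent_join that by auto
    then have "thin k (verts c'' - {})"
      using P by (intro thin_child[OF bent_join.prems(4) that(1)]) auto
    then show ?thesis using bent_join that meeting_child[OF _ that(1)] by (intro H) auto
  qed
  \<comment> \<open>The half in \<open>c'\<close> is not in the first child and takes
    \<open>Suc m\<close> levels, which is where \<open>m + 2\<close> comes from.\<close>
  ultimately have "reorderable d (Suc m) c''" if "c'' \<in> set cs" for c''
    using that reorderable_mono[of d m c'' "Suc m"] by force
  then show ?case
    using bent_join reorderable_mono[of d "Suc m" c "m + 2"]
    by (intro reorderable_Node[where h = c]) auto
qed

lemma ex_extremal:
  assumes "finite S" "S \<noteq> {}"
  obtains va vb where "va \<in> S" "\<And>v. v \<in> S \<Longrightarrow> l va \<le> l v" "vb \<in> S" "\<And>v. v \<in> S \<Longrightarrow> r v \<le> r vb"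
proof -
  obtain va where "va \<in> S" "\<And>v. v \<in> S \<Longrightarrow> l va \<le> l v"
    using ex_is_arg_min_if_finite[OF assms, of l] by (auto simp: is_arg_min_linorder)
  moreover obtain vb where "vb \<in> S" "\<And>v. v \<in> S \<Longrightarrow> r v \<le> r vb"
    using ex_is_arg_min_if_finite[OF assms, of "\<lambda>v. - r v"] by (auto simp: is_arg_min_linorder)
  ultimately show thesis using that by blast
qed

text \<open>Removing a path that covers the whole representation lowers the width by one and costs
  at most two levels.\<close>

lemma reorder_thin:
  assumes "proper t" "arity_le d t" "meeting (edges t)" "thin (Suc k) (verts t)"
  shows "reorderable d (2 * k) t"
  using assms
proof (induction k arbitrary: t)
  case 0
  show ?case
  proof (cases t)
    case (Node a cs)
    show ?thesis
    proof (cases cs)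
      case Nil
      then show ?thesis by (simp add: Node reorderable_leaf)
    next
      case (Cons c cs')
      \<comment> \<open>The larger of the two left ends lies in both intervals of an edge, so width
        0 admits no edge and the tree is a single vertex.\<close>
      let ?x = "max (l a) (l (apex c))"
      have m: "l a \<le> r (apex c)" "l (apex c) \<le> r a"
        using meeting_child[of a cs c] "0.prems" Node Cons by auto
      have ne: "a \<noteq> apex c" using "0.prems" Node Cons apex_in_verts[of c] by auto
      have "{a, apex c} \<subseteq> {v \<in> verts t. l v \<le> ?x \<and> ?x \<le> r v}"
        using m l_le_r Node Cons by auto
      then have "card {a, apex c} \<le> card {v \<in> verts t. l v \<le> ?x \<and> ?x \<le> r v}"
        by (intro card_mono) auto
      also have "\<dots> \<le> Suc 0" using "0.prems"(4) unfolding thin_def by blast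
      finally show ?thesis using ne by simp
    qed
  qed
next
  case (Suc k)
  obtain va vb where v: "va \<in> verts t" "\<And>v. v \<in> verts t \<Longrightarrow> l va \<le> l v"
      "vb \<in> verts t" "\<And>v. v \<in> verts t \<Longrightarrow> r v \<le> r vb"
    using ex_extremal[of "verts t"] by (metis finite_verts empty_iff apex_in_verts)
  obtain P where P: "bent_path t P"
    "\<And>x. l va \<le> x \<Longrightarrow> x \<le> r vb \<Longrightarrow> \<exists>w\<in>P. l w \<le> x \<and> x \<le> r w"
    using bent_path_cover[OF Suc.prems(3) v(1,3)] by blast
  have "thin (Suc k) (verts t - P)"
    by (rule thin_remove_cover[OF finite_verts Suc.prems(4) bent_path_subset[OF P(1)] v P(2)])
  then have "reorderable d (2 * k + 2) t"
    using reorder_bent_path[OF Suc.IH P(1)] Suc.prems by blast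
  then show ?case by simp
qed

end

section \<open>Moving the root to a leaf\<close>

text \<open>The root moves to a child \<open>e\<close> off the path: \<open>a\<close> exchanges the
  child \<open>e\<close> for a parent, so it keeps at most \<open>d\<close> children, and the path
  is prolonged at its top. This ends when the root has only the child on the path.\<close>

lemma reroot:
  assumes "proper (Node a (c # ds))" "length ds \<le> d" "1 \<le> d" "\<forall>x\<in>set (c # ds). arity_le d x"
    and "down_path c P"
  shows "\<exists>t P'. proper t \<and> arity_le d t \<and> verts t = verts (Node a (c # ds)) \<and>
    edges t = edges (Node a (c # ds)) \<and> down_path t P' \<and> insert a P \<subseteq> P'"
  using assms
proof (induction "size_list size ds" arbitrary: a c ds P rule: less_induct)
  case less
  show ?case
  proof (cases ds)
    case Nil
    then show ?thesis
      using less.prems down_step[of c "[c]" P a]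
      by (intro exI[of _ "Node a [c]"] exI[of _ "insert a P"]) auto
  next
    case (Cons e ds')
    obtain b es where e: "e = Node b es" by (cases e)
    let ?c = "Node a (c # ds')"
    have e_props: "verts c \<inter> verts e = {}" "a \<notin> verts e" "proper e" "proper ?c"
      "\<And>x. x \<in> set ds' \<Longrightarrow> verts x \<inter> verts e = {}"
      using less.prems(1) unfolding Cons by auto
    then have disj: "verts ?c \<inter> verts e = {}" by auto
    then have disj': "verts ?c \<inter> verts x = {}" if "x \<in> set es" for x
      using that unfolding e by auto
    have "?c \<notin> set es" using disj' apex_in_verts by blast
    moreover have "b \<notin> verts ?c" using disj unfolding e by auto
    ultimately have pr: "proper (Node b (?c # es))"
      using e_props(3,4) disj' unfolding e proper.simps(1)[of b] by (auto simp del: rtree.set)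
    \<comment> \<open>The measure falls because the trees in \<open>es\<close> are parts of the head
      \<open>e\<close> of \<open>ds\<close>.\<close>
    have "\<exists>t P'. proper t \<and> arity_le d t \<and> verts t = verts (Node b (?c # es)) \<and>
        edges t = edges (Node b (?c # es)) \<and> down_path t P' \<and> insert b (insert a P) \<subseteq> P'"
      by (rule less.hyps)
        (use less.prems pr in \<open>auto simp: Cons e intro: down_step\<close>)
    moreover have "verts (Node b (?c # es)) = verts (Node a (c # ds))"
      by (auto simp: Cons e)
    moreover have "edges (Node b (?c # es)) = edges (Node a (c # ds))"
      by (auto simp: Cons e insert_commute)
    ultimately show ?thesis by auto
  qed
qed

lemma down_path_apex: "down_path t {apex t}"
  by (cases t) (simp add: down_top)

lemma reroot_at_leaf:
  assumes t: "proper t" "length (children t) \<le> Suc d" "1 \<le> d" "\<forall>x\<in>set (children t). arity_le d x"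
    and P: "down_path t P"
  shows "\<exists>t' P'. proper t' \<and> arity_le d t' \<and> verts t' = verts t \<and> edges t' = edges t \<and>
    down_path t' P' \<and> P \<subseteq> P'"
proof -
  obtain a cs where tt: "t = Node a cs" by (cases t)
  show ?thesis
  proof (cases "cs = []")
    case True
    then show ?thesis using t P tt by (intro exI[of _ t] exI[of _ P]) auto
  next
    case False
    \<comment> \<open>If \<open>P\<close> consists of the root only, any child can serve as
      \<open>c\<close>, with \<open>Q\<close> its apex alone.\<close>
    have "\<exists>c\<in>set cs. \<exists>Q. down_path c Q \<and> P \<subseteq> insert a Q"
      using P unfolding tt
    proof cases
      case down_top
      then show ?thesis using False down_path_apex by (metis list.set_sel(1) empty_subsetI insert_mono)
    next
      case (down_step c Q)
      then show ?thesis by blast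
    qed
    then obtain c Q where c: "c \<in> set cs" "down_path c Q" "P \<subseteq> insert a Q" by blast
    define ds where "ds = remove1 c cs"
    have ds: "set (c # ds) = set cs" "distinct (c # ds)" "length cs = Suc (length ds)"
      using t(1) c(1) tt length_pos_if_in_set[OF c(1)] by (auto simp: ds_def length_remove1)
    have "proper (Node a (c # ds))" using t(1) ds unfolding tt proper.simps by metis
    moreover have "\<forall>x\<in>set (c # ds). arity_le d x" using t(4) ds tt by simp
    moreover have "verts (Node a (c # ds)) = verts t" "edges (Node a (c # ds)) = edges t"
      using ds(1) unfolding tt edges.simps rtree.set by metis+
    moreover have "length ds \<le> d" using t(2) ds(3) tt by simp
    ultimately show ?thesis
      using reroot[OF _ _ t(3) _ c(2), of a ds] c(3) by (metis order_trans)
  qed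
qed

subsection \<open>Rooting a graph-theoretic tree\<close>

lemma add_leaf:
  assumes "proper t" "u \<in> verts t" "w \<notin> verts t"
  shows "\<exists>t'. proper t' \<and> apex t' = apex t \<and> verts t' = insert w (verts t) \<and>
    edges t' = insert {u, w} (edges t)"
  using assms
proof (induction t)
  case (Node a cs)
  show ?case
  proof (cases "u = a")
    case True
    have "Node w [] \<notin> set cs" using Node.prems(3) by force
    then have "proper (Node a (Node w [] # cs))" using Node.prems by auto
    then show ?thesis
      using True by (intro exI[of _ "Node a (Node w [] # cs)"]) auto
  next
    case False
    then obtain c where c: "c \<in> set cs" "u \<in> verts c" using Node.prems by auto
    then obtain c' where c': "proper c'" "apex c' = apex c" "verts c' = insert w (verts c)"
        "edges c' = insert {u, w} (edges c)"
      using Node.IH[of c] Node.prems by auto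
    obtain xs ys where cs: "cs = xs @ c # ys" using split_list[OF c(1)] by blast
    let ?t = "Node a (xs @ c' # ys)"
    have w: "w \<notin> verts x" if "x \<in> set cs" for x using Node.prems(3) that by auto
    have "c' \<notin> set cs" using w c'(3) by blast
    moreover have "verts c' \<inter> verts x = {}" if "x \<in> set xs \<union> set ys" for x
    proof -
      have "x \<noteq> c" "x \<in> set cs" using Node.prems(1) that cs by auto
      then have "verts c \<inter> verts x = {}" using Node.prems(1) c(1) by auto
      then show ?thesis using w[OF \<open>x \<in> set cs\<close>] c'(3) by auto
    qed
    ultimately have "proper ?t"
      using Node.prems(1,3) c'(1,3) False unfolding cs by auto
    moreover have "verts ?t = insert w (verts (Node a cs))" using c'(3) cs by auto
    moreover have "edges ?t = insert {u, w} (edges (Node a cs))" using c'(2,4) cs by auto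
    ultimately show ?thesis by (metis rtree.sel(1))
  qed
qed

lemma apex_reaches:
  assumes "v \<in> verts t"
  shows "(apex t, v) \<in> {(x, y). {x, y} \<in> edges t}\<^sup>*"
  using assms
proof (induction t)
  case (Node a cs)
  show ?case
  proof (cases "v = a")
    case False
    then obtain c where c: "c \<in> set cs" "v \<in> verts c" using Node.prems by auto
    have "{(x, y). {x, y} \<in> edges c} \<subseteq> {(x, y). {x, y} \<in> edges (Node a cs)}"
      using c(1) by auto
    then have "(apex c, v) \<in> {(x, y). {x, y} \<in> edges (Node a cs)}\<^sup>*"
      using Node.IH[OF c] rtrancl_mono by blast
    moreover have "(a, apex c) \<in> {(x, y). {x, y} \<in> edges (Node a cs)}" using c(1) by auto
    ultimately show ?thesis by (simp add: converse_rtrancl_into_rtrancl)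
  qed simp
qed

lemma distinct_path:
  assumes "(x, y) \<in> {(x, y). {x, y} \<in> E}\<^sup>*"
  shows "\<exists>xs. xs \<noteq> [] \<and> distinct xs \<and> hd xs = x \<and> last xs = y \<and>
    successively (\<lambda>x y. {x, y} \<in> E) xs"
  using assms
proof (induction rule: rtrancl_induct)
  case base
  show ?case by (intro exI[of _ "[x]"]) simp
next
  case (step y z)
  then obtain xs where xs: "xs \<noteq> []" "distinct xs" "hd xs = x" "last xs = y"
    "successively (\<lambda>x y. {x, y} \<in> E) xs" by blast
  show ?case
  \<comment> \<open>If the walk returns to an earlier vertex, the path is cut off there.\<close>
  proof (cases "z \<in> set xs")
    case True
    then obtain ys zs where "xs = (ys @ [z]) @ zs"
      by (metis split_list append_Cons append_Nil append_assoc)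
    then show ?thesis
      using xs by (intro exI[of _ "ys @ [z]"])
        (auto simp: successively_append_iff hd_append split: if_splits)
  next
    case False
    then show ?thesis
      using xs step(2) by (intro exI[of _ "xs @ [z]"]) (auto simp: successively_append_iff)
  qed
qed

lemma closing_edge_cycle:
  assumes "distinct xs" "3 \<le> length xs" "successively (\<lambda>x y. {x, y} \<in> E) xs"
    "{last xs, hd xs} \<in> E"
  shows "graph_cycle E xs"
  unfolding graph_cycle_def
proof (intro conjI allI impI)
  fix i assume i: "i < length xs"
  show "{xs ! i, xs ! (Suc i mod length xs)} \<in> E"
  proof (cases "Suc i = length xs")
    case True
    moreover have "xs \<noteq> []" using assms(2) by auto
    then have "last xs = xs ! i" "hd xs = xs ! 0"
      by (simp_all add: last_conv_nth hd_conv_nth flip: True)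
    ultimately show ?thesis using assms(4) by simp
  next
    case False
    then show ?thesis using i assms(3) by (simp add: successively_conv_nth)
  qed
qed (use assms in auto)

text \<open>A rooted subtree of largest size spans \<open>V\<close>, since otherwise connectedness
  yields an edge leaving it, which adds a leaf. It contains all of \<open>E\<close>, since a missing
  edge would close a cycle with the tree path between its ends.\<close>

lemma rooted_tree_exists:
  assumes T: "graph_tree V E" and r: "a \<in> V"
  shows "\<exists>t. proper t \<and> apex t = a \<and> verts t = V \<and> edges t = E"
proof -
  have fin: "finite V" and E: "E \<subseteq> nsets V 2" and con: "graph_connected V E"
    and acyc: "\<nexists>vs. graph_cycle E vs"
    using T unfolding graph_tree_def simple_graph_def by auto
  define Q where "Q t \<longleftrightarrow> proper t \<and> apex t = a \<and> verts t \<subseteq> V \<and> edges t \<subseteq> E" for t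
  have "Q (Node a [])" using r by (simp add: Q_def)
  moreover have "\<forall>t. Q t \<longrightarrow> card (verts t) < Suc (card V)"
    using fin by (auto simp: Q_def less_Suc_eq_le intro: card_mono)
  ultimately obtain t where t: "Q t" "\<And>t'. Q t' \<Longrightarrow> card (verts t') \<le> card (verts t)"
    using ex_has_greatest_nat[of Q "Node a []" "\<lambda>t. card (verts t)"] by blast
  have VV: "verts t = V"
  proof (rule ccontr)
    assume "verts t \<noteq> V"
    then obtain v where v: "v \<in> V" "v \<notin> verts t" using t(1) by (auto simp: Q_def)
    have "(a, v) \<in> {(x, y). {x, y} \<in> E}\<^sup>*" using con r v(1) unfolding graph_connected_def by blast
    then have "v \<in> verts t \<or> (\<exists>x y. {x, y} \<in> E \<and> x \<in> verts t \<and> y \<notin> verts t)"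
    proof (induction rule: rtrancl_induct)
      case base
      then show ?case using t(1) apex_in_verts[of t] by (auto simp: Q_def)
    qed auto
    then obtain x y where xy: "{x, y} \<in> E" "x \<in> verts t" "y \<notin> verts t" using v by blast
    then obtain t' where "proper t'" "apex t' = apex t" "verts t' = insert y (verts t)"
      "edges t' = insert {x, y} (edges t)"
      using add_leaf[of t x y] t(1) by (auto simp: Q_def)
    moreover have "y \<in> V" using xy(1) E by (auto simp: nsets_def)
    ultimately have "Q t'" "card (verts t') = Suc (card (verts t))"
      using xy t(1) by (auto simp: Q_def)
    then show False using t(2)[of t'] by simp
  qed
  have "e \<in> edges t" if e: "e \<in> E" for e
  proof (rule ccontr)
    assume ne: "e \<notin> edges t"
    obtain x y where xy: "e = {x, y}" "x \<noteq> y" "x \<in> V" "y \<in> V"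
      using e E by (auto elim!: nsets2_E)
    let ?R = "{(x, y). {x, y} \<in> edges t}"
    have "sym ?R" by (auto simp: sym_def insert_commute)
    then have "sym (?R\<^sup>*)" by (rule sym_rtrancl)
    then have "(x, y) \<in> ?R\<^sup>*"
      using apex_reaches[of x t] apex_reaches[of y t] xy VV by (meson rtrancl_trans symD)
    then obtain xs where xs: "xs \<noteq> []" "distinct xs" "hd xs = x" "last xs = y"
      "successively (\<lambda>x y. {x, y} \<in> edges t) xs"
      using distinct_path[of x y "edges t"] by blast
    \<comment> \<open>The ends differ and are not adjacent in \<open>t\<close>, so the tree path has
      at least three vertices.\<close>
    have "length xs \<noteq> 1" using xs xy(2) by (auto simp: length_Suc_conv)
    moreover have "length xs \<noteq> 2"
    proof
      assume "length xs = 2"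
      then obtain p q where "xs = [p, q]" by (auto simp: length_Suc_conv numeral_2_eq_2)
      then show False using xs ne xy(1) by simp
    qed
    moreover have "length xs \<noteq> 0" using xs(1) by simp
    ultimately have "3 \<le> length xs" by linarith
    moreover have "successively (\<lambda>x y. {x, y} \<in> E) xs"
      using xs(5) t(1) by (auto simp: Q_def intro: successively_mono)
    moreover have "{last xs, hd xs} \<in> E" using xs xy e by (simp add: insert_commute)
    ultimately show False using closing_edge_cycle[OF xs(2)] acyc by blast
  qed
  then show ?thesis using t(1) VV by (auto simp: Q_def)
qed

section \<open>Vertex degrees and numbers of children\<close>

lemma card_child_edges:
  assumes "proper (Node a cs)"
  shows "card ((\<lambda>c. {a, apex c}) ` set cs) = length cs"
proof -
  have "inj_on (\<lambda>c. {a, apex c}) (set cs)"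
  proof (rule inj_onI, rule ccontr)
    fix x y assume *: "x \<in> set cs" "y \<in> set cs" "{a, apex x} = {a, apex y}" "x \<noteq> y"
    then have "verts x \<inter> verts y = {}" "a \<notin> verts x" "a \<notin> verts y" using assms by auto
    then show False using *(3) apex_in_verts[of x] apex_in_verts[of y]
      by (metis disjoint_iff doubleton_eq_iff)
  qed
  then show ?thesis using assms by (simp add: card_image distinct_card)
qed

text \<open>The edge to the parent \<open>p\<close> differs from those to the children, so it takes
  one of the at most \<open>Suc d\<close> edges at the apex.\<close>

lemma arity_le_degree:
  assumes "proper t" "edges t \<subseteq> E" "finite E" "\<forall>v\<in>verts t. vertex_degree E v \<le> Suc d"
    and "{p, apex t} \<in> E" "p \<notin> verts t"
  shows "arity_le d t"
  using assms
proof (induction t arbitrary: p)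
  case (Node a cs)
  let ?F = "(\<lambda>c. {a, apex c}) ` set cs"
  have "{p, a} \<notin> ?F"
  proof
    assume "{p, a} \<in> ?F"
    then obtain c where "c \<in> set cs" "{p, a} = {a, apex c}" by blast
    then have "p \<in> verts (Node a cs)"
      using bspec[of "set cs"] apex_in_verts[of c] by (fastforce simp: doubleton_eq_iff)
    then show False using Node.prems by blast
  qed
  then have "Suc (length cs) = card (insert {p, a} ?F)"
    using card_child_edges[OF Node.prems(1)] by simp
  also have "\<dots> \<le> vertex_degree E a"
    unfolding vertex_degree_def
    by (rule card_mono) (use Node.prems in auto)
  also have "\<dots> \<le> Suc d" using Node.prems(4) by simp
  finally have "length cs \<le> d" by simp
  moreover have "arity_le d c" if "c \<in> set cs" for c
    using that Node.prems by (intro Node.IH[where p = a]) auto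
  ultimately show ?case by simp
qed

lemma arity_le_children:
  assumes "proper t" "edges t \<subseteq> E" "finite E" "\<forall>v\<in>verts t. vertex_degree E v \<le> Suc d"
  shows "length (children t) \<le> Suc d" "\<forall>c\<in>set (children t). arity_le d c"
proof -
  obtain a cs where t: "t = Node a cs" by (cases t)
  have "length cs = card ((\<lambda>c. {a, apex c}) ` set cs)"
    using card_child_edges assms(1) t by metis
  also have "\<dots> \<le> vertex_degree E a"
    unfolding vertex_degree_def
    by (rule card_mono) (use assms t in auto)
  also have "\<dots> \<le> Suc d" using assms(4) t by simp
  finally show "length (children t) \<le> Suc d" using t by simp
  show "\<forall>c\<in>set (children t). arity_le d c"
    using assms t by (auto intro!: arity_le_degree[where p = a and E = E])
qed

subsection \<open>Plane drawings\<close>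

lemma plane_drawing_cong:
  assumes "plane_drawing V E q" "\<And>v. v \<in> V \<Longrightarrow> p v = q v" "\<And>e. e \<in> E \<Longrightarrow> e \<subseteq> V"
  shows "plane_drawing V E p"
proof -
  have e: "p u = q u" "p v = q v" if "{u, v} \<in> E" for u v
    using assms(3)[of "{u, v}"] assms(2) that by auto
  have "inj_on p V" using assms(1,2) unfolding plane_drawing_def straight_line_drawing_def
    by (simp cong: inj_on_cong)
  moreover have "w \<in> {u, v}" if "{u, v} \<in> E" "w \<in> V" "p w \<in> closed_segment (p u) (p v)" for u v w
    using assms(1) that e[OF that(1)] assms(2)[OF that(2)]
    unfolding plane_drawing_def straight_line_drawing_def by metis
  moreover have "closed_segment (p u) (p v) \<inter> closed_segment (p x) (p y) \<subseteq> p ` ({u, v} \<inter> {x, y})"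
    if *: "{u, v} \<in> E" "{x, y} \<in> E" "{u, v} \<noteq> {x, y}" for u v x y
  proof -
    have "p ` ({u, v} \<inter> {x, y}) = q ` ({u, v} \<inter> {x, y})"
      using e[OF *(1)] by (intro image_cong) auto
    then show ?thesis
      using assms(1) * e[OF *(1)] e[OF *(2)] unfolding plane_drawing_def by metis
  qed
  ultimately show ?thesis unfolding plane_drawing_def straight_line_drawing_def by blast
qed

lemma plane_drawing_translate:
  assumes "plane_drawing V E q"
  shows "plane_drawing V E (\<lambda>v. z + q v)"
proof -
  have seg: "closed_segment (z + x) (z + y) = (+) z ` closed_segment x y" for x y
    by (simp add: closed_segment_translation)
  have "inj_on (\<lambda>v. z + q v) V"
    using assms unfolding plane_drawing_def straight_line_drawing_def by (auto simp: inj_on_def)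
  moreover have "closed_segment (z + q u) (z + q v) \<inter> closed_segment (z + q x) (z + q y)
      \<subseteq> (\<lambda>v. z + q v) ` ({u, v} \<inter> {x, y})"
    if "{u, v} \<in> E" "{x, y} \<in> E" "{u, v} \<noteq> {x, y}" for u v x y
  proof -
    have "closed_segment (q u) (q v) \<inter> closed_segment (q x) (q y) \<subseteq> q ` ({u, v} \<inter> {x, y})"
      using assms that unfolding plane_drawing_def by blast
    then show ?thesis unfolding seg by (auto simp: subset_iff)
  qed
  moreover have "w \<in> {u, v}"
    if "{u, v} \<in> E" "w \<in> V" "z + q w \<in> closed_segment (z + q u) (z + q v)" for u v w
  proof -
    have "q w \<in> closed_segment (q u) (q v)" using that(3) unfolding seg by auto
    then show ?thesis
      using assms that unfolding plane_drawing_def straight_line_drawing_def by blast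
  qed
  ultimately show ?thesis unfolding plane_drawing_def straight_line_drawing_def by blast
qed

lemma plane_drawing_edge:
  assumes "p a \<noteq> p b"
  shows "plane_drawing {a, b} {{a, b}} p"
  using assms unfolding plane_drawing_def straight_line_drawing_def by auto

text \<open>Two pieces share no point but \<open>p a\<close>. Within its own piece, an edge through
  \<open>p a\<close> has \<open>a\<close> as an endpoint, so edges of different pieces meet only at
  a common endpoint \<open>a\<close>.\<close>

lemma plane_drawing_glue:
  assumes plane: "\<And>i. i \<in> I \<Longrightarrow> plane_drawing (V i) (E i) p"
    and a: "\<And>i. i \<in> I \<Longrightarrow> a \<in> V i"
    and V: "\<And>i v. i \<in> I \<Longrightarrow> v \<in> V i \<Longrightarrow> p v \<in> R i"
    and E: "\<And>i u v. i \<in> I \<Longrightarrow> {u, v} \<in> E i \<Longrightarrow> closed_segment (p u) (p v) \<subseteq> R i"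
    and R: "\<And>i j. i \<in> I \<Longrightarrow> j \<in> I \<Longrightarrow> i \<noteq> j \<Longrightarrow> R i \<inter> R j \<subseteq> {p a}"
  shows "plane_drawing (\<Union>i\<in>I. V i) (\<Union>i\<in>I. E i) p"
proof -
  have inj: "inj_on p (V i)" if "i \<in> I" for i
    using plane[OF that] unfolding plane_drawing_def straight_line_drawing_def by blast
  have seg: "w \<in> {u, v}"
    if "i \<in> I" "{u, v} \<in> E i" "w \<in> V i" "p w \<in> closed_segment (p u) (p v)" for i u v w
    using plane[OF that(1)] that unfolding plane_drawing_def straight_line_drawing_def by blast
  have only_a: "v = a" if "i \<in> I" "v \<in> V i" "p v = p a" for i v
    using inj_onD[OF inj[OF that(1)] that(3,2) a[OF that(1)]] .
  have "inj_on p (\<Union>i\<in>I. V i)"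
  proof (rule inj_onI)
    fix x y assume "x \<in> (\<Union>i\<in>I. V i)" "y \<in> (\<Union>i\<in>I. V i)" and eq: "p x = p y"
    then obtain i j where ij: "i \<in> I" "x \<in> V i" "j \<in> I" "y \<in> V j" by blast
    show "x = y"
    proof (cases "i = j")
      case True
      then show ?thesis using inj[of i] ij eq by (auto dest: inj_onD)
    next
      case False
      then have "p x = p a" using R[OF ij(1,3)] V[OF ij(1,2)] V[OF ij(3,4)] eq by auto
      then show ?thesis using only_a ij eq by metis
    qed
  qed
  moreover have "w \<in> {u, v}"
    if uv: "{u, v} \<in> (\<Union>i\<in>I. E i)" and w: "w \<in> (\<Union>i\<in>I. V i)" "p w \<in> closed_segment (p u) (p v)"
    for u v w
  proof -
    obtain i j where ij: "i \<in> I" "{u, v} \<in> E i" "j \<in> I" "w \<in> V j" using uv w by blast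
    show ?thesis
    proof (cases "i = j")
      case True
      then show ?thesis using seg ij w(2) by blast
    next
      case False
      then have "p w = p a" using R[OF ij(1,3)] E[OF ij(1,2)] V[OF ij(3,4)] w(2) by blast
      then have "w = a" using only_a ij by blast
      then show ?thesis using seg[OF ij(1,2) a[OF ij(1)]] w(2) by blast
    qed
  qed
  moreover have "closed_segment (p u) (p v) \<inter> closed_segment (p x) (p y) \<subseteq> p ` ({u, v} \<inter> {x, y})"
    if *: "{u, v} \<in> (\<Union>i\<in>I. E i)" "{x, y} \<in> (\<Union>i\<in>I. E i)" "{u, v} \<noteq> {x, y}" for u v x y
  proof -
    obtain i j where ij: "i \<in> I" "{u, v} \<in> E i" "j \<in> I" "{x, y} \<in> E j" using *(1,2) by blast
    show ?thesis
    proof (cases "i = j")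
      case True
      then show ?thesis using plane[OF ij(1)] ij *(3) unfolding plane_drawing_def by blast
    next
      case False
      show ?thesis
      proof
        fix q assume q: "q \<in> closed_segment (p u) (p v) \<inter> closed_segment (p x) (p y)"
        then have "q = p a" using R[OF ij(1,3) False] E[OF ij(1,2)] E[OF ij(3,4)] by blast
        moreover from this have "a \<in> {u, v}" "a \<in> {x, y}"
          using seg[OF ij(1,2) a[OF ij(1)]] seg[OF ij(3,4) a[OF ij(3)]] q by blast+
        ultimately show "q \<in> p ` ({u, v} \<inter> {x, y})" by blast
      qed
    qed
  qed
  ultimately show ?thesis unfolding plane_drawing_def straight_line_drawing_def by blast
qed

text \<open>Gluing at \<open>apex c\<close>: the translated subtree lies in the half-plane right of
  \<open>z\<close>, which the segment from 0 reaches only at its end because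
  \<open>0 < Re z\<close>.\<close>

lemma plane_drawing_branch:
  assumes q: "plane_drawing (verts c) (edges c) q" "q (apex c) = 0" "\<And>v. v \<in> verts c \<Longrightarrow> 0 \<le> Re (q v)"
    and z: "0 < Re z" and a: "p a = 0" and p: "\<And>v. v \<in> verts c \<Longrightarrow> p v = z + q v"
  shows "plane_drawing (insert a (verts c)) (insert {a, apex c} (edges c)) p"
proof -
  \<comment> \<open>The index is Boolean: \<open>True\<close> stands for the subtree,
    \<open>False\<close> for the edge leading to it.\<close>
  define V where "V i = (if i then verts c else {a, apex c})" for i
  define E where "E i = (if i then edges c else {{a, apex c}})" for i
  define R where "R i = (if i then {w. Re z \<le> Re w} else closed_segment 0 z)" for i
  have pz: "p (apex c) = z" using p[of "apex c"] q(2) by simp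
  have "plane_drawing (\<Union>i\<in>UNIV. V i) (\<Union>i\<in>UNIV. E i) p"
  proof (rule plane_drawing_glue[where R = R and a = "apex c"])
    fix i
    show "plane_drawing (V i) (E i) p"
    proof (cases i)
      case True
      have "plane_drawing (verts c) (edges c) p"
        by (rule plane_drawing_cong[OF plane_drawing_translate[OF q(1), of z]])
          (use p edges_subset in auto)
      then show ?thesis using True by (simp add: V_def E_def)
    next
      case False
      have "p a \<noteq> p (apex c)" using a pz z by auto
      then show ?thesis using False plane_drawing_edge by (simp add: V_def E_def)
    qed
    show "apex c \<in> V i" by (simp add: V_def)
    show "p v \<in> R i" if "v \<in> V i" for v
      using that p q(3) a pz by (auto simp: V_def R_def split: if_splits)
    show "closed_segment (p x) (p y) \<subseteq> R i" if xy: "{x, y} \<in> E i" for x y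
    proof (cases i)
      case True
      then have "x \<in> verts c" "y \<in> verts c" using xy edge_in_verts[of x y c] by (auto simp: E_def)
      then have "closed_segment (p x) (p y) \<subseteq> {w. Re z \<le> Re w}"
        using p q(3) by (intro closed_segment_subset convex_halfspace_Re_ge) auto
      then show ?thesis using True by (simp add: R_def)
    next
      case False
      then show ?thesis
        using xy a pz by (auto simp: E_def R_def doubleton_eq_iff closed_segment_commute)
    qed
    fix j
    have "w = z" if w: "Re z \<le> Re w" "w \<in> closed_segment 0 z" for w
    proof -
      obtain t where t: "0 \<le> t" "t \<le> 1" "w = t *\<^sub>R z" using w(2) by (auto simp: in_segment)
      have "(1 - t) * Re z \<le> 0" using w(1) t(3) by (simp add: algebra_simps)
      then have "t = 1" using z t(2) by (auto simp: mult_le_0_iff)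
      then show ?thesis using t(3) by simp
    qed
    then show "R i \<inter> R j \<subseteq> {p (apex c)}" if "i \<noteq> j"
      using that pz by (auto simp: R_def)
  qed
  moreover have "(\<Union>i\<in>UNIV. V i) = insert a (verts c)" by (auto simp: V_def UNIV_bool)
  moreover have "(\<Union>i\<in>UNIV. E i) = insert {a, apex c} (edges c)" by (auto simp: E_def UNIV_bool)
  ultimately show ?thesis by simp
qed

text \<open>An edge at level \<open>m\<close> has length \<open>B ^ m\<close>, so a tree on at most \<open>n\<close> vertices drawn at
  level \<open>m - 1\<close> fits into a disc of radius \<open>\<epsilon> * B ^ m\<close>.\<close>

locale directions =
  fixes d n :: nat and u :: "nat \<Rightarrow> complex" and \<epsilon> B :: real
  assumes u_0: "u 0 = 1"
    and u_norm: "\<And>i. i < d \<Longrightarrow> cmod (u i) = 1"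
    and u_pos: "\<And>i. 0 < i \<Longrightarrow> i < d \<Longrightarrow> 0 < Re (u i) \<and> Re (u i) \<le> 1/2 \<and> 0 < Im (u i)"
    and eps: "0 < \<epsilon>" "\<epsilon> < 1/2"
    and u_sep: "\<And>i j. 0 < i \<Longrightarrow> i < d \<Longrightarrow> 0 < j \<Longrightarrow> j < d \<Longrightarrow> i \<noteq> j \<Longrightarrow>
      2 * \<epsilon> < \<bar>Im (cnj (u i) * u j)\<bar>"
    and B: "1 \<le> B" "real n \<le> \<epsilon> * B"
begin

section \<open>Separating the branches at a vertex\<close>

text \<open>The edge to child \<open>i\<close> together with the room for its subtree. The first
  subtree, at the same level, keeps a whole half-plane; the others get a small disc around the tip,
  without its lower half so that it stays above the real axis.\<close>

definition region :: "real \<Rightarrow> nat \<Rightarrow> complex set" where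
  "region L i = closed_segment 0 (of_real L * u i) \<union>
    (if i = 0 then {w. L \<le> Re w}
     else cball (of_real L * u i) (\<epsilon> * L) \<inter> {w. L * Im (u i) \<le> Im w})"

lemma region_cases:
  assumes "w \<in> region L i"
  obtains (seg) t where "0 \<le> t" "t \<le> 1" "w = of_real (t * L) * u i"
  | (first) "i = 0" "L \<le> Re w"
  | (later) "0 < i" "cmod (w - of_real L * u i) \<le> \<epsilon> * L" "L * Im (u i) \<le> Im w"
proof -
  consider "w \<in> closed_segment 0 (of_real L * u i)" | "i = 0" "L \<le> Re w"
    | "0 < i" "cmod (w - of_real L * u i) \<le> \<epsilon> * L" "L * Im (u i) \<le> Im w"
    using assms unfolding region_def by (auto split: if_splits simp: dist_norm norm_minus_commute)
  then show thesis
  proof cases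
    case 1
    then obtain t where "0 \<le> t" "t \<le> 1" "w = t *\<^sub>R (of_real L * u i)" by (auto simp: in_segment)
    then show thesis using seg[of t] by (simp add: scaleR_conv_of_real mult.assoc)
  qed (use first later in auto)
qed

text \<open>\<open>Re (u j) \<le> 1/2\<close> and \<open>\<epsilon> < 1/2\<close> keep region
  \<open>j\<close> strictly left of the half-plane. So \<open>w\<close> lies on the real axis, which
  region \<open>j\<close> touches only at 0.\<close>

lemma region_first_meet:
  assumes L: "0 < L" and j: "0 < j" "j < d" and w: "w \<in> region L 0" "w \<in> region L j"
  shows "w = 0"
proof -
  note uj = u_pos[OF j]
  have "Re w < L"
    using w(2)
  proof (cases rule: region_cases)
    case (seg t)
    have "t * Re (u j) \<le> 1 * (1/2)" using seg uj by (intro mult_mono) auto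
    then have "L * (t * Re (u j)) \<le> L * (1/2)" using L by (intro mult_left_mono) auto
    then show ?thesis using L seg by (simp add: algebra_simps)
  next
    case later
    have "Re w - L * Re (u j) \<le> \<epsilon> * L"
      using complex_Re_le_cmod[of "w - of_real L * u j"] later by simp
    moreover have "L * Re (u j) \<le> L * (1/2)" using L uj by (intro mult_left_mono) auto
    moreover have "\<epsilon> * L < 1/2 * L" using L eps by (intro mult_strict_right_mono) auto
    ultimately show ?thesis by simp
  qed (use j in simp)
  have "Im w = 0"
    using w(1)
  proof (cases rule: region_cases)
    case first
    then show ?thesis using \<open>Re w < L\<close> by simp
  qed (auto simp: u_0)
  show ?thesis
    using w(2)
  proof (cases rule: region_cases)
    case (seg t)
    then have "t * L = 0" using \<open>Im w = 0\<close> uj by simp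
    then show ?thesis using seg by (simp del: of_real_mult)
  next
    case later
    then have "L * Im (u j) \<le> 0" using \<open>Im w = 0\<close> by simp
    then show ?thesis using L uj by (simp add: mult_le_0_iff)
  qed (use j in simp)
qed

text \<open>The functional \<open>w \<mapsto> Im (cnj (u i) * w)\<close> vanishes on the line spanned by \<open>u i\<close>;
  its size separates branch \<open>i\<close> from the subtrees at the tips of the other non-first branches.\<close>

lemma cross_self: "Im (cnj (u i) * (of_real t * u i)) = 0"
  by (simp add: algebra_simps)

lemma cross_le: "i < d \<Longrightarrow> \<bar>Im (cnj (u i) * w)\<bar> \<le> cmod w"
  using abs_Im_le_cmod[of "cnj (u i) * w"] by (simp add: norm_mult u_norm)

text \<open>In distance from the line through \<open>u i\<close>, the segment contributes 0 and the
  disc, centred on that line, at most its radius.\<close>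

lemma cross_region:
  assumes "0 < L" "0 < i" "i < d" "w \<in> region L i"
  shows "\<bar>Im (cnj (u i) * w)\<bar> \<le> \<epsilon> * L"
  using assms(4)
proof (cases rule: region_cases)
  case (seg t)
  then show ?thesis using cross_self[of i "t * L"] eps assms(1) by simp
next
  case later
  have "Im (cnj (u i) * w) = Im (cnj (u i) * (w - of_real L * u i))"
    using cross_self[of i L] by (simp add: right_diff_distrib)
  then show ?thesis using cross_le[OF assms(3), of "w - of_real L * u i"] later by simp
qed (use assms in simp)

text \<open>By \<open>u_sep\<close> the tip of one branch is more than
  \<open>2 * \<epsilon> * L\<close> away from the line of the other, so its disc misses the strip
  around that line. Two segments lie on different lines through 0.\<close>

lemma region_later_meet:
  assumes L: "0 < L" and i: "0 < i" "i < d" and j: "0 < j" "j < d" and ij: "i \<noteq> j"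
    and w: "w \<in> region L i" "w \<in> region L j"
  shows "w = 0"
proof -
  have far: False if a: "0 < a" "a < d" and b: "0 < b" "b < d" and ab: "a \<noteq> b"
    and wa: "w \<in> region L a" and wb: "cmod (w - of_real L * u b) \<le> \<epsilon> * L" for a b
  proof -
    have "Im (cnj (u a) * w) = L * Im (cnj (u a) * u b) + Im (cnj (u a) * (w - of_real L * u b))"
      by (simp add: algebra_simps)
    moreover have "\<bar>L * Im (cnj (u a) * u b)\<bar> > L * (2 * \<epsilon>)"
      using u_sep[OF a b ab] L by (simp add: abs_mult)
    moreover have "\<bar>Im (cnj (u a) * (w - of_real L * u b))\<bar> \<le> \<epsilon> * L"
      using cross_le[OF a(2), of "w - of_real L * u b"] wb by linarith
    ultimately show False using cross_region[OF L a wa] by (simp add: algebra_simps)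
  qed
  show ?thesis
    using w(2)
  proof (cases rule: region_cases)
    case (seg t)
    show ?thesis
      using w(1)
    proof (cases rule: region_cases)
      case seg': (seg s)
      have "Im (cnj (u i) * w) = 0" using cross_self[of i "s * L"] seg' by simp
      moreover have "Im (cnj (u i) * w) = t * L * Im (cnj (u i) * u j)"
        using seg by (simp add: algebra_simps)
      moreover have "Im (cnj (u i) * u j) \<noteq> 0" using u_sep[OF i j ij] eps by linarith
      ultimately have "t * L = 0" by (metis mult_eq_0_iff)
      then show ?thesis using seg by (simp del: of_real_mult)
    next
      case later
      then show ?thesis using far[OF j i] ij w by blast
    qed (use i in simp)
  next
    case later
    then show ?thesis using far[OF i j ij] w by blast
  qed (use j in simp)
qed

lemma region_meet:
  assumes "0 < L" "i < d" "j < d" "i \<noteq> j"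
  shows "region L i \<inter> region L j \<subseteq> {0}"
proof
  fix w assume w: "w \<in> region L i \<inter> region L j"
  consider "i = 0" "0 < j" | "0 < i" "j = 0" | "0 < i" "0 < j" using assms(4) by linarith
  then show "w \<in> {0}"
  proof cases
    case 1
    then show ?thesis using w assms region_first_meet[of L j w] by auto
  next
    case 2
    then show ?thesis using w assms region_first_meet[of L i w] by auto
  next
    case 3
    then show ?thesis using w assms region_later_meet[of L i j w] by auto
  qed
qed

section \<open>Drawing by recursion\<close>

text \<open>The induction invariant. Nonnegative coordinates put a shifted subtree to the right of
  and above its tip, and the norm bound makes subtrees one level below fit their discs. The sign
  \<open>s\<close> is there because edges are unordered.\<close>

definition drawn :: "nat \<Rightarrow> 'a rtree \<Rightarrow> ('a \<Rightarrow> complex) \<Rightarrow> bool" where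
  "drawn m t p \<longleftrightarrow> p (apex t) = 0 \<and> plane_drawing (verts t) (edges t) p \<and>
     (\<forall>v\<in>verts t. 0 \<le> Re (p v) \<and> 0 \<le> Im (p v) \<and> cmod (p v) \<le> real (card (verts t)) * B ^ m) \<and>
     (\<forall>x y. {x, y} \<in> edges t \<longrightarrow>
       (\<exists>i<d. \<exists>j\<in>{1..m}. \<exists>s\<in>{1, -1}. p y - p x = of_real (s * B ^ j) * u i))"

lemma u_nonneg: "i < d \<Longrightarrow> 0 < Re (u i) \<and> 0 \<le> Im (u i)"
  using u_pos[of i] u_0 by (cases "i = 0") auto

lemma drawn_Node:
  assumes t: "proper (Node a cs)" "length cs \<le> d" "card (verts (Node a cs)) \<le> n"
    and cs: "cs \<noteq> []" and m: "1 \<le> m"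
    and P: "\<And>i. i < length cs \<Longrightarrow> drawn (if i = 0 then m else m - 1) (cs ! i) (P i)"
  shows "\<exists>p. drawn m (Node a cs) p"
proof -
  define N where "N = length cs"
  define L where "L = B ^ m"
  have L: "0 < L" "B ^ (m - 1) \<le> L" "1 \<le> B ^ (m - 1)" "L = B * B ^ (m - 1)"
    using B m by (auto simp: L_def power_increasing one_le_power simp flip: power_Suc)
  \<comment> \<open>The subtrees are disjoint, so \<open>THE\<close> picks the one child containing
    \<open>v\<close>, whose drawing is shifted to the tip of its edge.\<close>
  define p where "p v = (if v = a then 0 else
    let i = (THE i. i < N \<and> v \<in> verts (cs ! i)) in of_real L * u i + P i v)" for v
  have disj: "verts (cs ! i) \<inter> verts (cs ! j) = {}" if "i < N" "j < N" "i \<noteq> j" for i j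
    using t(1) that by (auto simp: N_def nth_eq_iff_index_eq)
  have a: "a \<notin> verts (cs ! i)" if "i < N" for i using t(1) that by (simp add: N_def)
  have pa: "p a = 0" by (simp add: p_def)
  have p: "p v = of_real L * u i + P i v" if "i < N" "v \<in> verts (cs ! i)" for i v
  proof -
    have "(THE i. i < N \<and> v \<in> verts (cs ! i)) = i"
      using that disj by (intro the_equality) blast+
    then show ?thesis using that a by (auto simp: p_def Let_def)
  qed
  have set: "set cs = (\<lambda>i. cs ! i) ` {..<N}" by (auto simp: N_def set_conv_nth)
  have verts: "verts (Node a cs) = (\<Union>i\<in>{..<N}. insert a (verts (cs ! i)))"
    using cs by (auto simp: set N_def)
  have edges: "edges (Node a cs) = (\<Union>i\<in>{..<N}. insert {a, apex (cs ! i)} (edges (cs ! i)))"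
    by (simp add: set)
  \<comment> \<open>The vertex \<open>a\<close>, not counted in the subtree, pays for the edge of
    length \<open>L\<close> in the norm bound.\<close>
  have card: "card (verts (cs ! i)) + 1 \<le> card (verts (Node a cs))" if "i < N" for i
  proof -
    have "card (insert a (verts (cs ! i))) \<le> card (verts (Node a cs))"
      using that by (intro card_mono) (auto simp: N_def)
    then show ?thesis using a[OF that] by simp
  qed
  have Pi: "P i (apex (cs ! i)) = 0" "plane_drawing (verts (cs ! i)) (edges (cs ! i)) (P i)"
    "\<And>v. v \<in> verts (cs ! i) \<Longrightarrow> 0 \<le> Re (P i v)" "\<And>v. v \<in> verts (cs ! i) \<Longrightarrow> 0 \<le> Im (P i v)"
    if "i < N" for i
    using P[of i] that by (auto simp: drawn_def N_def)
  have Pn: "cmod (P i v) \<le> real (card (verts (cs ! i))) * L" if "i < N" "v \<in> verts (cs ! i)" for i v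
  proof -
    have "cmod (P i v) \<le> real (card (verts (cs ! i))) * B ^ (if i = 0 then m else m - 1)"
      using P[of i] that by (auto simp: drawn_def N_def)
    also have "\<dots> \<le> real (card (verts (cs ! i))) * L"
      using L(2) by (intro mult_left_mono) (auto simp: L_def)
    finally show ?thesis .
  qed
  have Pe: "cmod (P i v) \<le> \<epsilon> * L" if "0 < i" "i < N" "v \<in> verts (cs ! i)" for i v
  proof -
    have "cmod (P i v) \<le> real (card (verts (cs ! i))) * B ^ (m - 1)"
      using P[of i] that by (auto simp: drawn_def N_def)
    also have "\<dots> \<le> \<epsilon> * B * B ^ (m - 1)"
      using card[OF that(2)] t(3) B L(3) by (intro mult_right_mono) auto
    finally show ?thesis using L(4) by (simp add: mult.assoc)
  qed
  have iN: "i < d" if "i < N" for i using that t(2) by (simp add: N_def)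
  \<comment> \<open>The part of \<open>region L i\<close> meant for the subtree; being convex, it
    contains an edge once it contains both ends.\<close>
  let ?W = "\<lambda>i. if i = 0 then {w. L \<le> Re w}
     else cball (of_real L * u i) (\<epsilon> * L) \<inter> {w. L * Im (u i) \<le> Im w}"
  have W: "p v \<in> ?W i" if "i < N" "v \<in> verts (cs ! i)" for i v
    using that p[OF that] Pi(3,4)[OF that] Pe[OF _ that] by (auto simp: u_0 dist_norm)
  have W_convex: "convex (?W i)" for i
    by (auto intro: convex_Int convex_halfspace_Re_ge convex_halfspace_Im_ge)
  have "plane_drawing (verts (Node a cs)) (edges (Node a cs)) p"
    unfolding verts edges
  proof (rule plane_drawing_glue[where R = "region L" and a = a])
    fix i assume "i \<in> {..<N}"
    then have i: "i < N" by simp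
    note u = u_nonneg[OF iN[OF i]]
    show "plane_drawing (insert a (verts (cs ! i))) (insert {a, apex (cs ! i)} (edges (cs ! i))) p"
      by (rule plane_drawing_branch[where q = "P i" and z = "of_real L * u i"])
        (use Pi[OF i] p[OF i] pa u L in auto)
    show "p v \<in> region L i" if "v \<in> insert a (verts (cs ! i))" for v
      using that W[OF i, of v] pa unfolding region_def by auto
    show "closed_segment (p x) (p y) \<subseteq> region L i"
      if xy: "{x, y} \<in> insert {a, apex (cs ! i)} (edges (cs ! i))" for x y
    proof (cases "{x, y} \<in> edges (cs ! i)")
      case True
      then have "closed_segment (p x) (p y) \<subseteq> ?W i"
        using W[OF i] W_convex edge_in_verts[OF True] by (intro closed_segment_subset) auto
      then show ?thesis unfolding region_def by blast
    next
      case False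
      then have "{x, y} = {a, apex (cs ! i)}" using xy by simp
      moreover have "p (apex (cs ! i)) = of_real L * u i"
        using p[OF i apex_in_verts] Pi(1)[OF i] by simp
      ultimately have "closed_segment (p x) (p y) = closed_segment 0 (of_real L * u i)"
        using pa by (auto simp: doubleton_eq_iff closed_segment_commute)
      then show ?thesis unfolding region_def by blast
    qed
    show "region L i \<inter> region L j \<subseteq> {p a}" if "j \<in> {..<N}" "i \<noteq> j" for j
      using region_meet[OF L(1) iN[OF i], of j] iN[of j] that pa by auto
  qed auto
  moreover have "0 \<le> Re (p v) \<and> 0 \<le> Im (p v) \<and> cmod (p v) \<le> real (card (verts (Node a cs))) * B ^ m"
    if v: "v \<in> verts (Node a cs)" for v
  proof (cases "v = a")
    case True
    then show ?thesis using pa L by (auto simp flip: L_def)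
  next
    case False
    then obtain i where i: "i < N" "v \<in> verts (cs ! i)" using v unfolding verts by (auto split: if_splits)
    note u = u_nonneg[OF iN[OF i(1)]]
    have "cmod (p v) \<le> cmod (of_real L * u i) + cmod (P i v)"
      unfolding p[OF i] by (rule norm_triangle_ineq)
    also have "\<dots> \<le> L + real (card (verts (cs ! i))) * L"
      using Pn[OF i] u_norm[OF iN[OF i(1)]] L(1) by (simp add: norm_mult)
    also have "\<dots> = real (card (verts (cs ! i)) + 1) * L" by (simp add: algebra_simps)
    also have "\<dots> \<le> real (card (verts (Node a cs))) * L"
      using card[OF i(1)] L by (intro mult_right_mono) auto
    finally show ?thesis using p[OF i] u Pi(3,4)[OF i] L by (simp add: L_def)
  qed
  moreover have "\<exists>i<d. \<exists>j\<in>{1..m}. \<exists>s\<in>{1, -1}. p y - p x = of_real (s * B ^ j) * u i"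
    if xy: "{x, y} \<in> edges (Node a cs)" for x y
  proof -
    obtain i where i: "i < N" "{x, y} = {a, apex (cs ! i)} \<or> {x, y} \<in> edges (cs ! i)"
      using xy unfolding edges by auto
    from i(2) show ?thesis
    proof
      assume e: "{x, y} = {a, apex (cs ! i)}"
      have "p (apex (cs ! i)) = of_real (B ^ m) * u i"
        using p[OF i(1) apex_in_verts] Pi(1)[OF i(1)] by (simp add: L_def)
      then have "p y - p x = of_real (1 * B ^ m) * u i \<or> p y - p x = of_real (- 1 * B ^ m) * u i"
        using e pa by (auto simp: doubleton_eq_iff)
      then show ?thesis using iN[OF i(1)] m
        by (intro exI[of _ i] conjI bexI[of _ m]) (blast, auto)
    next
      assume e: "{x, y} \<in> edges (cs ! i)"
      have "p y - p x = P i y - P i x" using p[OF i(1)] edge_in_verts[OF e] by simp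
      moreover obtain i' j s where "i' < d" "j \<in> {1..(if i = 0 then m else m - 1)}" "s \<in> {1, -1}"
        "P i y - P i x = of_real (s * B ^ j) * u i'"
        using P[of i] i(1) e unfolding drawn_def N_def by blast
      moreover from this have "j \<in> {1..m}" by (auto split: if_splits)
      ultimately show ?thesis by metis
    qed
  qed
  ultimately show ?thesis unfolding drawn_def using pa by auto
qed

lemma drawn_exists:
  assumes "proper t" "arity_le d t" "rank_le m t" "card (verts t) \<le> n"
  shows "\<exists>p. drawn m t p"
  using assms
proof (induction t arbitrary: m)
  case (Node a cs)
  show ?case
  proof (cases cs)
    case Nil
    then show ?thesis
      using B by (intro exI[of _ "\<lambda>_. 0"])
        (auto simp: drawn_def plane_drawing_def straight_line_drawing_def)
  next
    case (Cons c cs')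
    have m: "1 \<le> m" "rank_le m c" "\<forall>x\<in>set cs'. rank_le (m - 1) x"
      using Node.prems(3) Cons by auto
    have "\<exists>q. drawn (if i = 0 then m else m - 1) (cs ! i) q" if i: "i < length cs" for i
    proof (rule Node.IH)
      show mem: "cs ! i \<in> set cs" using i by simp
      show "proper (cs ! i)" "arity_le d (cs ! i)" using Node.prems mem by auto
      show "rank_le (if i = 0 then m else m - 1) (cs ! i)"
        using m i Cons by (cases i) auto
      have "verts (cs ! i) \<subseteq> verts (Node a cs)" using mem by auto
      then show "card (verts (cs ! i)) \<le> n"
        using Node.prems(4) card_mono[OF finite_verts] le_trans by blast
    qed
    then obtain P where "\<And>i. i < length cs \<Longrightarrow> drawn (if i = 0 then m else m - 1) (cs ! i) (P i)"
      by metis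
    then show ?thesis using drawn_Node Node.prems Cons m(1) by (metis arity_le.simps list.discI)
  qed
qed

end

section \<open>Counting slopes and lengths\<close>

lemma slope_scale:
  assumes "b - a = of_real c * w" "c \<noteq> 0"
  shows "slope a b = slope 0 w"
proof -
  have "(\<exists>r::real. b - a = of_real r * cis \<theta>) \<longleftrightarrow> (\<exists>r::real. w - 0 = of_real r * cis \<theta>)" for \<theta>
  proof
    assume "\<exists>r::real. b - a = of_real r * cis \<theta>"
    then obtain r :: real where "of_real c * w = of_real r * cis \<theta>" using assms(1) by auto
    then have "w - 0 = of_real (r / c) * cis \<theta>" using assms(2) by (simp add: field_simps)
    then show "\<exists>r::real. w - 0 = of_real r * cis \<theta>" by blast
  next
    assume "\<exists>r::real. w - 0 = of_real r * cis \<theta>"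
    then obtain r :: real where "w = of_real r * cis \<theta>" by auto
    then have "b - a = of_real (c * r) * cis \<theta>" using assms(1) by simp
    then show "\<exists>r::real. b - a = of_real r * cis \<theta>" by blast
  qed
  then show ?thesis unfolding slope_def by simp
qed

context directions
begin

text \<open>The direction alone determines the slope, as a nonzero real factor keeps the line, and
  the exponent alone determines the length.\<close>

lemma drawn_slopes_lengths:
  assumes "drawn m t p"
  shows "card (edge_slopes (edges t) p) \<le> d" "card (edge_lengths (edges t) p) \<le> m"
proof -
  have e: "\<exists>i<d. \<exists>j\<in>{1..m}. \<exists>s\<in>{1, -1}. p y - p x = of_real (s * B ^ j) * u i"
    if "{x, y} \<in> edges t" for x y
    using assms that unfolding drawn_def by blast
  have "edge_slopes (edges t) p \<subseteq> (\<lambda>i. slope 0 (u i)) ` {..<d}"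
  proof
    fix \<theta> assume "\<theta> \<in> edge_slopes (edges t) p"
    then obtain x y where xy: "{x, y} \<in> edges t" "\<theta> = slope (p x) (p y)"
      unfolding edge_slopes_def by blast
    then obtain i j s where "i < d" "s \<in> {1, -1}" "p y - p x = of_real (s * B ^ j) * u i"
      using e by blast
    moreover from this have "s * B ^ j \<noteq> 0" using B by auto
    ultimately show "\<theta> \<in> (\<lambda>i. slope 0 (u i)) ` {..<d}"
      using slope_scale[of "p y" "p x" "s * B ^ j" "u i"] xy(2) by auto
  qed
  then show "card (edge_slopes (edges t) p) \<le> d"
    using surj_card_le[of "{..<d}"] by simp
  have "edge_lengths (edges t) p \<subseteq> (\<lambda>j. B ^ j) ` {1..m}"
  proof
    fix \<theta> assume "\<theta> \<in> edge_lengths (edges t) p"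
    then obtain x y where xy: "{x, y} \<in> edges t" "\<theta> = dist (p x) (p y)"
      unfolding edge_lengths_def by blast
    then obtain i j s where ijs: "i < d" "j \<in> {1..m}" "s \<in> {1, -1}"
      "p y - p x = of_real (s * B ^ j) * u i"
      using e by blast
    have "\<theta> = cmod (p y - p x)" using xy(2) by (simp add: dist_norm norm_minus_commute)
    also have "\<dots> = B ^ j"
      using ijs B u_norm[OF ijs(1)] unfolding ijs(4) norm_mult norm_of_real by (auto simp: abs_mult)
    finally show "\<theta> \<in> (\<lambda>j. B ^ j) ` {1..m}" using ijs(2) by blast
  qed
  then show "card (edge_lengths (edges t) p) \<le> m"
    using surj_card_le[of "{1..m}"] by simp
qed

end

section \<open>Choice of directions\<close>

lemma directions_exist: "\<exists>u \<epsilon> B. directions d n u \<epsilon> B"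
proof -
  \<comment> \<open>Evenly spaced angles between 60 and 90 degrees: the lower end gives
    \<open>Re (u i) \<le> 1/2\<close>, the upper end a positive real part.\<close>
  define \<phi> where "\<phi> i = pi/3 + pi/6 * (real i / real d)" for i
  define u where "u i = (if i = 0 then 1 else cis (\<phi> i))" for i :: nat
  define S where "S = {\<bar>Im (cnj (u i) * u j)\<bar> | i j. i \<in> {0<..<d} \<and> j \<in> {0<..<d} \<and> i \<noteq> j}"
  have phi: "pi/3 < \<phi> i \<and> \<phi> i < pi/2" if "0 < i" "i < d" for i
  proof -
    have "0 < real i / real d" "real i / real d < 1" using that by auto
    then have "0 < pi/6 * (real i / real d)" "pi/6 * (real i / real d) < pi/6 * 1"
      by (auto intro: mult_strict_left_mono simp del: times_divide_eq_right)
    then show ?thesis by (simp add: \<phi>_def)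
  qed
  have "S \<subseteq> (\<lambda>(i, j). \<bar>Im (cnj (u i) * u j)\<bar>) ` ({0<..<d} \<times> {0<..<d})"
    by (auto simp: S_def)
  then have fin: "finite S" by (rule finite_subset) auto
  have pos: "0 < x" if x: "x \<in> S" for x
  proof -
    obtain i j where ij: "x = \<bar>Im (cnj (u i) * u j)\<bar>" "0 < i" "i < d" "0 < j" "j < d" "i \<noteq> j"
      using x by (auto simp: S_def)
    \<comment> \<open>The cross value is the sine of the angle difference, which is nonzero for
      different angles less than \<open>pi\<close> apart.\<close>
    have "cnj (u i) * u j = cis (\<phi> j - \<phi> i)"
      using ij by (simp add: u_def cis_cnj cis_mult)
    then have "x = \<bar>sin (\<phi> j - \<phi> i)\<bar>" using ij(1) by simp
    moreover have "\<phi> j - \<phi> i \<noteq> 0" using ij by (simp add: \<phi>_def divide_eq_eq)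
    moreover have "- pi < \<phi> j - \<phi> i" "\<phi> j - \<phi> i < pi"
      using phi[of i] phi[of j] ij by linarith+
    ultimately show ?thesis using sin_eq_0_pi[of "\<phi> j - \<phi> i"] by auto
  qed
  \<comment> \<open>The 1 keeps the minimum defined when \<open>S\<close> is empty and makes
    \<open>\<epsilon>\<close> at most 1/4; the quarter leaves \<open>2 * \<epsilon>\<close> strictly
    below every element of \<open>S\<close>.\<close>
  define \<epsilon> where "\<epsilon> = Min (insert 1 S) / 4"
  have "0 < Min (insert 1 S)" using fin pos by (subst Min_gr_iff) auto
  moreover have "Min (insert 1 S) \<le> 1" using fin by (intro Min_le) auto
  ultimately have eps: "0 < \<epsilon>" "\<epsilon> < 1/2" unfolding \<epsilon>_def by linarith+
  have sep: "2 * \<epsilon> < x" if "x \<in> S" for x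
  proof -
    have "Min (insert 1 S) \<le> x" using fin that by (intro Min_le) auto
    then show ?thesis using pos[OF that] unfolding \<epsilon>_def by linarith
  qed
  \<comment> \<open>\<open>Suc n\<close> instead of \<open>n\<close> makes the base at least 1 even
    for \<open>n = 0\<close>.\<close>
  have "directions d n u \<epsilon> (real (Suc n) / \<epsilon>)"
  proof
    show "u 0 = 1" by (simp add: u_def)
    show "cmod (u i) = 1" for i by (simp add: u_def)
    show "0 < Re (u i) \<and> Re (u i) \<le> 1/2 \<and> 0 < Im (u i)" if "0 < i" "i < d" for i
    proof -
      have "cos (\<phi> i) \<le> cos (pi/3)" using phi[OF that] by (intro cos_monotone_0_pi_le) auto
      then show ?thesis
        using phi[OF that] that by (auto simp: u_def cos_60 intro: cos_gt_zero sin_gt_zero)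
    qed
    show "2 * \<epsilon> < \<bar>Im (cnj (u i) * u j)\<bar>" if "0 < i" "i < d" "0 < j" "j < d" "i \<noteq> j" for i j
      using that by (intro sep) (auto simp: S_def)
    show "1 \<le> real (Suc n) / \<epsilon>" "real n \<le> \<epsilon> * (real (Suc n) / \<epsilon>)"
      using eps by (auto simp: field_simps)
  qed (use eps in auto)
  then show ?thesis by blast
qed

subsection \<open>From pathwidth to drawings\<close>

lemma pathwidth_intervals:
  assumes G: "simple_graph V E" and k: "pathwidth V E = k"
  obtains l r :: "'a \<Rightarrow> real" where "intervals l r" "intervals.meeting l r E" "intervals.thin l r (Suc k) V"
proof -
  have fin: "finite V" using G by (simp add: simple_graph_def)
  have "\<exists>F. interval_graph V F \<and> E \<subseteq> F \<and> \<not> (\<exists>K. K \<subseteq> V \<and> card K = k + 2 \<and> clique K F)"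
    unfolding k[symmetric] pathwidth_def by (rule LeastI_ex) (rule pathwidth_witness[OF G])
  then obtain F where F: "interval_graph V F" "E \<subseteq> F"
    "\<not> (\<exists>K. K \<subseteq> V \<and> card K = k + 2 \<and> clique K F)"
    by (elim exE conjE)
  obtain l0 r0 :: "'a \<Rightarrow> real" where lr: "\<forall>v\<in>V. l0 v \<le> r0 v"
    "\<forall>u\<in>V. \<forall>v\<in>V. u \<noteq> v \<longrightarrow> ({u, v} \<in> F \<longleftrightarrow> {l0 u..r0 u} \<inter> {l0 v..r0 v} \<noteq> {})"
    using F(1) unfolding interval_graph_def by (elim exE conjE)
  \<comment> \<open>Outside \<open>V\<close> the interval is the point 0, since the locale asks for
    \<open>l v \<le> r v\<close> everywhere.\<close>
  define l where "l v = (if v \<in> V then l0 v else 0)" for v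
  define r where "r v = (if v \<in> V then r0 v else 0)" for v
  interpret intervals l r by standard (use lr in \<open>auto simp: l_def r_def\<close>)
  have "meeting E"
    unfolding meeting_def
  proof (intro allI impI)
    fix x y assume e: "{x, y} \<in> E"
    then have "{x, y} \<in> nsets V 2" using G unfolding simple_graph_def by blast
    then have xy: "x \<in> V" "y \<in> V" "x \<noteq> y" unfolding doubleton_in_nsets_2 by auto
    then have "{l0 x..r0 x} \<inter> {l0 y..r0 y} \<noteq> {}" using lr(2) e F(2) by blast
    then show "l x \<le> r y" using xy by (auto simp: l_def r_def)
  qed
  moreover have "thin (Suc k) V"
    unfolding thin_def
  proof (rule allI, rule ccontr)
    fix x
    let ?C = "{v \<in> V. l v \<le> x \<and> x \<le> r v}"
    assume "\<not> card ?C \<le> Suc k"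
    \<comment> \<open>Vertices whose intervals share \<open>x\<close> are pairwise adjacent in
      \<open>F\<close>, so \<open>k + 2\<close> of them form a forbidden clique.\<close>
    then have "k + 2 \<le> card ?C" by simp
    then obtain K where K: "K \<subseteq> ?C" "card K = k + 2"
      by (rule obtain_subset_with_card_n)
    have "clique K F"
      unfolding clique_def
    proof (intro ballI impI)
      fix v w assume vw: "v \<in> K" "w \<in> K" "v \<noteq> w"
      then have "v \<in> V" "w \<in> V" "x \<in> {l0 v..r0 v} \<inter> {l0 w..r0 w}"
        using K(1) by (auto simp: l_def r_def split: if_splits)
      then show "{v, w} \<in> F" using lr(2) vw(3) by blast
    qed
    then show False using F(3) K by blast
  qed
  ultimately show thesis using that intervals_axioms by blast
qed

theorem theorem5:
  fixes V :: "'a set" and E :: "'a set set" and k :: nat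
  assumes "graph_tree V E" and "pathwidth V E = k" and "k \<ge> 1"
  shows "\<exists>p :: 'a \<Rightarrow> complex. plane_drawing V E p \<and>
           card (edge_slopes E p) \<le> max (max_degree V E - 1) 1 \<and>
           card (edge_lengths E p) \<le> 2 * k - 1"
proof -
  have G: "simple_graph V E" and finV: "finite V" and E: "E \<subseteq> nsets V 2" and V: "V \<noteq> {}"
    using assms(1) unfolding graph_tree_def simple_graph_def graph_connected_def by auto
  have finE: "finite E" using E finV by (meson finite_imp_finite_nsets finite_subset)
  obtain k' where k': "k = Suc k'" using assms(3) by (cases k) auto
  \<comment> \<open>Bounds the children of every vertex once the root is a leaf. The maximum with 1
    leaves room for the single child of the root.\<close>
  define d where "d = max (max_degree V E - 1) 1"
  have deg: "\<forall>v\<in>V. vertex_degree E v \<le> Suc d"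
  proof
    fix v assume "v \<in> V"
    then have "vertex_degree E v \<le> max_degree V E"
      unfolding max_degree_def using finV by (intro Max_ge) auto
    then show "vertex_degree E v \<le> Suc d" by (simp add: d_def)
  qed
  obtain l r :: "'a \<Rightarrow> real" where lr: "intervals l r" "intervals.meeting l r E"
    "intervals.thin l r (Suc k) V"
    using pathwidth_intervals[OF G assms(2)] .
  interpret intervals l r by (rule lr(1))
  obtain va vb where v: "va \<in> V" "\<And>v. v \<in> V \<Longrightarrow> l va \<le> l v" "vb \<in> V" "\<And>v. v \<in> V \<Longrightarrow> r v \<le> r vb"
    using ex_extremal[OF finV V] by blast
  \<comment> \<open>Rooting at the end \<open>va\<close> makes the covering path a downward path,
    which costs one level instead of two.\<close>
  obtain t where t: "proper t" "apex t = va" "verts t = V" "edges t = E"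
    using rooted_tree_exists[OF assms(1) v(1)] by blast
  obtain P where P: "down_path t P"
    "\<And>x. l va \<le> x \<Longrightarrow> x \<le> r vb \<Longrightarrow> \<exists>w\<in>P. l w \<le> x \<and> x \<le> r w"
    using down_path_cover[of t vb] lr(2) t v(3) by auto
  have thin: "thin k (V - P)"
    by (rule thin_remove_cover[OF finV lr(3) _ v P(2)])
      (use down_path_subset[OF P(1)] t(3) in auto)
  have "edges t \<subseteq> E" "\<forall>v\<in>verts t. vertex_degree E v \<le> Suc d" using t deg by auto
  note ar = arity_le_children[OF t(1) this(1) finE this(2)]
  \<comment> \<open>Rerooting only prolongs the path, so what remains after its removal is still
    thin.\<close>
  obtain t1 P1 where t1: "proper t1" "arity_le d t1" "verts t1 = V" "edges t1 = E"
    "down_path t1 P1" "P \<subseteq> P1"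
    using reroot_at_leaf[OF t(1) ar(1) _ ar(2) P(1)] t by (auto simp: d_def)
  have "thin (Suc k') (verts t1 - P1)"
    using thin_subset[OF thin] t1(3,6) finV k' by auto
  \<comment> \<open>Off the path \<open>2 * k'\<close> levels suffice and the path adds one, which
    gives \<open>Suc (2 * k') = 2 * k - 1\<close>.\<close>
  then have "reorderable d (Suc (2 * k')) t1"
    using reorder_down_path[OF reorder_thin t1(5,1,2)] t1(4) lr(2) by simp
  then obtain t2 where t2: "verts t2 = V" "edges t2 = E" "proper t2" "arity_le d t2"
    "rank_le (Suc (2 * k')) t2"
    using t1 unfolding reorderable_def by auto
  obtain u \<epsilon> B where "directions d (card V) u \<epsilon> B" using directions_exist by blast
  then interpret directions d "card V" u \<epsilon> B .
  obtain p where p: "drawn (Suc (2 * k')) t2 p"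
    using drawn_exists[OF t2(3,4,5)] t2(1) by auto
  then have "plane_drawing V E p" using t2 by (simp add: drawn_def)
  then show ?thesis
    using drawn_slopes_lengths[OF p] t2(2) unfolding d_def k' by auto
qed

end
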